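(* Let $T>0$, $I=[-T,T]$, $a,b\in\mathbb{R}$, $h\in L^1(I)$, and suppose that $a^2-b^2\neq n^2(\pi/T)^2$ for all $n=0,1,2,\dots$. Then the problem $$x'(t)+a\,x(-t)+b\,x(t)=h(t),\quad t\in I,\qquad x(-T)=x(T),$$ has a unique solution, given by $$u(t):=\int_{-T}^{T}\overline G(t,s)h(s)\,ds,\qquad \overline G(t,s):=a\,G(-t,s)-b\,G(t,s)+\frac{\partial G}{\partial t}(t,s),$$ where $G$ is the Green's function associated with the problem $$x''(t)+(a^2-b^2)x(t)=0,\quad t\in I,\qquad x(-T)=x(T),\quad x'(-T)=x'(T).$$
   Context: A solution of the first-order problem is an absolutely continuous function on $I$ satisfying the equation almost everywhere and the boundary condition. The Green's function $G:I\times I\to\mathbb{R}$ of the second-order periodic problem is the continuous function such that for every $f\in L^1(I)$ the unique solution of $x''+(a^2-b^2)x=f$ a.e. on $I$, $x(-T)=x(T)$, $x'(-T)=x'(T)$, is $x(t)=\int_{-T}^TG(t,s)f(s)\,ds$; it is differentiable in $t$ for $t\ne s$. *)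

theory Defs
  imports "HOL-Analysis.Analysis"
begin

text \<open>
  Functions on \<open>[-T, T]\<close> are functions on \<^typ>\<open>real\<close> whose values outside the interval are ignored:
  derivatives are taken within the interval (hence one-sided at \<open>-T\<close> and \<open>T\<close>), and uniqueness
  of a solution means equality on the interval.
\<close>

text \<open>
  The members \<open>K\<close> of a division are nonempty compact intervals with pairwise disjoint interiors,
  so \<^term>\<open>Inf K\<close> and \<^term>\<open>Sup K\<close> are the endpoints of \<open>K\<close>.
\<close>

definition abs_continuous_on :: "real set \<Rightarrow> (real \<Rightarrow> real) \<Rightarrow> bool" where
  "abs_continuous_on S f \<longleftrightarrow>
     (\<forall>\<epsilon>>0. \<exists>\<delta>>0. \<forall>\<D>. \<D> division_of \<Union>\<D> \<and> \<Union>\<D> \<subseteq> S \<and> (\<Sum>K\<in>\<D>. Sup K - Inf K) < \<delta> \<longrightarrow>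
        (\<Sum>K\<in>\<D>. \<bar>f (Sup K) - f (Inf K)\<bar>) < \<epsilon>)"

definition reflection_solution ::
    "real \<Rightarrow> real \<Rightarrow> real \<Rightarrow> (real \<Rightarrow> real) \<Rightarrow> (real \<Rightarrow> real) \<Rightarrow> bool" where
  "reflection_solution T a b h x \<longleftrightarrow>
     abs_continuous_on {-T..T} x \<and>
     (AE t in lebesgue_on {-T..T}.
        \<exists>x'. (x has_real_derivative x') (at t within {-T..T}) \<and> x' + a * x (-t) + b * x t = h t) \<and>
     x (-T) = x T"

text \<open>
  A solution of the second-order problem is a differentiable function \<open>x\<close> on \<open>[-T, T]\<close> whose
  derivative \<open>y\<close> is absolutely continuous; the second derivative exists almost everywhere.
\<close>

definition periodic_solution ::
    "real \<Rightarrow> real \<Rightarrow> (real \<Rightarrow> real) \<Rightarrow> (real \<Rightarrow> real) \<Rightarrow> bool" where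
  "periodic_solution T c f x \<longleftrightarrow>
     (\<exists>y. (\<forall>t\<in>{-T..T}. (x has_real_derivative y t) (at t within {-T..T})) \<and>
          abs_continuous_on {-T..T} y \<and>
          (AE t in lebesgue_on {-T..T}.
             \<exists>y'. (y has_real_derivative y') (at t within {-T..T}) \<and> y' + c * x t = f t) \<and>
          x (-T) = x T \<and> y (-T) = y T)"

definition periodic_greens_function ::
    "real \<Rightarrow> real \<Rightarrow> (real \<Rightarrow> real \<Rightarrow> real) \<Rightarrow> bool" where
  "periodic_greens_function T c G \<longleftrightarrow>
     continuous_on ({-T..T} \<times> {-T..T}) (\<lambda>(t, s). G t s) \<and>
     (\<forall>f. integrable (lebesgue_on {-T..T}) f \<longrightarrow>
        periodic_solution T c f (\<lambda>t. LINT s|lebesgue_on {-T..T}. G t s * f s) \<and>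
        (\<forall>x. periodic_solution T c f x \<longrightarrow>
           (\<forall>t\<in>{-T..T}. x t = (LINT s|lebesgue_on {-T..T}. G t s * f s))))"

definition partial_t :: "real \<Rightarrow> (real \<Rightarrow> real \<Rightarrow> real) \<Rightarrow> real \<Rightarrow> real \<Rightarrow> real" where
  "partial_t T G t s = vector_derivative (\<lambda>r. G r s) (at t within {-T..T})"

text \<open>
  On the diagonal \<open>t = s\<close> the partial derivative need not exist and the value is unspecified;
  for fixed \<open>t\<close> this concerns a single \<open>s\<close> and does not affect integrals over \<open>s\<close>.
\<close>

definition reflection_kernel ::
    "real \<Rightarrow> real \<Rightarrow> real \<Rightarrow> (real \<Rightarrow> real \<Rightarrow> real) \<Rightarrow> real \<Rightarrow> real \<Rightarrow> real" where
  "reflection_kernel T a b G t s = a * G (-t) s - b * G t s + partial_t T G t s"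

end

theory Submission imports Defs begin

text \<open>
  If \<open>x\<close> solves \<open>x'' + (a\<^sup>2 - b\<^sup>2) x = h\<close> with periodic boundary values, then
  \<open>u(t) = a x(-t) - b x(t) + x'(t)\<close> is periodic and a direct substitution gives
  \<open>u'(t) + a u(-t) + b u(t) = h(t)\<close>; inserting \<open>x = \<integral> G h\<close> turns \<open>u\<close> into the stated integral.
  Conversely, the difference \<open>z\<close> of two solutions of the first-order problem satisfies
  \<open>z'(t) = - a z(-t) - b z(t)\<close>, which is continuous, so \<open>z\<close> is twice differentiable with
  \<open>z'' + (a\<^sup>2 - b\<^sup>2) z = 0\<close> and periodic \<open>z\<close>, \<open>z'\<close>; off resonance this forces \<open>z = 0\<close>.

  With \<open>C\<close>, \<open>S\<close> the solutions of \<open>y'' + c y = 0\<close> normalised at \<open>0\<close>, the Green's function is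
  \<open>C (T - \<bar>t - s\<bar>) / (2 c S(T))\<close>. Any other Green's function coincides with it on the square,
  as one sees by testing both against their difference. Passing between almost-everywhere
  derivatives and absolutely continuous functions rests on the two halves of Lebesgue's
  fundamental theorem of calculus, obtained here from the Henstock-Kurzweil integral.
\<close>

section \<open>Absolutely continuous functions\<close>

lemma division_of_real_bounds:
  fixes \<D> :: "real set set"
  assumes "\<D> division_of D" "K \<in> \<D>"
  shows "K = {Inf K..Sup K}" "Inf K \<le> Sup K" "Inf K \<in> K" "Sup K \<in> K"
proof -
  obtain u v where K: "K = {u..v}" and "u \<le> v"
    using division_ofD(3,4)[OF assms] by (metis atLeastatMost_empty_iff2 box_real(2))
  have "Inf K = u" "Sup K = v"
    unfolding K using \<open>u \<le> v\<close> by simp_all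
  then show "K = {Inf K..Sup K}" "Inf K \<le> Sup K" "Inf K \<in> K" "Sup K \<in> K"
    using K \<open>u \<le> v\<close> by simp_all
qed

text \<open>Increments over each interval of a division are compared termwise, so smallness of the
  sums for \<open>f\<close> and \<open>g\<close> passes to \<open>h\<close>. Lipschitz functions,
  sums, products and change of representative are all instances.\<close>

lemma abs_continuous_on_dominated:
  fixes h :: "real \<Rightarrow> real"
  assumes f: "abs_continuous_on S f" and g: "abs_continuous_on S g"
    and le: "\<And>u v. u \<in> S \<Longrightarrow> v \<in> S \<Longrightarrow> \<bar>h v - h u\<bar> \<le> B * \<bar>f v - f u\<bar> + C * \<bar>g v - g u\<bar>"
  shows "abs_continuous_on S h"
  unfolding abs_continuous_on_def
proof (intro allI impI)
  fix e :: real assume "0 < e"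
  \<comment> \<open>The absolute values allow constants of either sign and the summand 1 keeps
    \<open>A\<close> positive; each of the two sums is then allotted
    \<open>e / (2 * A)\<close>.\<close>
  define A where "A = \<bar>B\<bar> + \<bar>C\<bar> + 1"
  have "A > 0" by (simp add: A_def add_nonneg_pos)
  then have e': "0 < e / (2 * A)" using \<open>0 < e\<close> by simp
  obtain d1 where d1: "0 < d1" "\<forall>\<D>. \<D> division_of \<Union>\<D> \<and> \<Union>\<D> \<subseteq> S \<and> (\<Sum>K\<in>\<D>. Sup K - Inf K) < d1 \<longrightarrow>
       (\<Sum>K\<in>\<D>. \<bar>f (Sup K) - f (Inf K)\<bar>) < e / (2 * A)"
    using f[unfolded abs_continuous_on_def, rule_format, OF e'] by (elim exE conjE)
  obtain d2 where d2: "0 < d2" "\<forall>\<D>. \<D> division_of \<Union>\<D> \<and> \<Union>\<D> \<subseteq> S \<and> (\<Sum>K\<in>\<D>. Sup K - Inf K) < d2 \<longrightarrow>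
       (\<Sum>K\<in>\<D>. \<bar>g (Sup K) - g (Inf K)\<bar>) < e / (2 * A)"
    using g[unfolded abs_continuous_on_def, rule_format, OF e'] by (elim exE conjE)
  show "\<exists>\<delta>>0. \<forall>\<D>. \<D> division_of \<Union>\<D> \<and> \<Union>\<D> \<subseteq> S \<and> (\<Sum>K\<in>\<D>. Sup K - Inf K) < \<delta> \<longrightarrow>
        (\<Sum>K\<in>\<D>. \<bar>h (Sup K) - h (Inf K)\<bar>) < e"
  proof (intro exI[of _ "min d1 d2"] conjI allI impI)
    fix \<D> assume D: "\<D> division_of \<Union>\<D> \<and> \<Union>\<D> \<subseteq> S \<and> (\<Sum>K\<in>\<D>. Sup K - Inf K) < min d1 d2"
    have "(\<Sum>K\<in>\<D>. \<bar>h (Sup K) - h (Inf K)\<bar>)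
        \<le> (\<Sum>K\<in>\<D>. A * \<bar>f (Sup K) - f (Inf K)\<bar> + A * \<bar>g (Sup K) - g (Inf K)\<bar>)"
    proof (rule sum_mono)
      fix K assume "K \<in> \<D>"
      then have "Inf K \<in> S" "Sup K \<in> S"
        using D division_of_real_bounds(3,4)[OF conjunct1[OF D]] by (meson UnionI subsetD)+
      then have "\<bar>h (Sup K) - h (Inf K)\<bar> \<le> B * \<bar>f (Sup K) - f (Inf K)\<bar> + C * \<bar>g (Sup K) - g (Inf K)\<bar>"
        by (rule le)
      also have "\<dots> \<le> A * \<bar>f (Sup K) - f (Inf K)\<bar> + A * \<bar>g (Sup K) - g (Inf K)\<bar>"
        by (intro add_mono mult_right_mono) (auto simp: A_def)
      finally show "\<bar>h (Sup K) - h (Inf K)\<bar> \<le> A * \<bar>f (Sup K) - f (Inf K)\<bar> + A * \<bar>g (Sup K) - g (Inf K)\<bar>" .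
    qed
    also have "\<dots> = A * (\<Sum>K\<in>\<D>. \<bar>f (Sup K) - f (Inf K)\<bar>) + A * (\<Sum>K\<in>\<D>. \<bar>g (Sup K) - g (Inf K)\<bar>)"
      by (simp add: sum.distrib sum_distrib_left)
    also have "\<dots> < A * (e / (2 * A)) + A * (e / (2 * A))"
      using D \<open>A > 0\<close> by (intro add_strict_mono mult_strict_left_mono d1(2)[rule_format] d2(2)[rule_format]) auto
    also have "\<dots> = e" using \<open>A > 0\<close> by (simp add: field_simps)
    finally show "(\<Sum>K\<in>\<D>. \<bar>h (Sup K) - h (Inf K)\<bar>) < e" .
  qed (use d1 d2 in auto)
qed

lemma abs_continuous_on_ident: "abs_continuous_on S (\<lambda>x. x)"
  unfolding abs_continuous_on_def
proof (intro allI impI)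
  fix e :: real assume "0 < e"
  have "(\<Sum>K\<in>\<D>. \<bar>Sup K - Inf K\<bar>) = (\<Sum>K\<in>\<D>. Sup K - Inf K)" if "\<D> division_of \<Union>\<D>"
    for \<D> :: "real set set"
    using division_of_real_bounds(2)[OF that] by (intro sum.cong refl abs_of_nonneg) simp
  with \<open>0 < e\<close> show "\<exists>\<delta>>0. \<forall>\<D>. \<D> division_of \<Union>\<D> \<and> \<Union>\<D> \<subseteq> S \<and> (\<Sum>K\<in>\<D>. Sup K - Inf K) < \<delta> \<longrightarrow>
        (\<Sum>K\<in>\<D>. \<bar>Sup K - Inf K\<bar>) < e"
    by (intro exI[of _ e]) simp
qed

lemma abs_continuous_on_Lipschitz:
  assumes "\<And>u v. u \<in> S \<Longrightarrow> v \<in> S \<Longrightarrow> \<bar>f v - f u\<bar> \<le> B * \<bar>v - u\<bar>"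
  shows "abs_continuous_on S f"
  by (rule abs_continuous_on_dominated[OF abs_continuous_on_ident abs_continuous_on_ident, of _ _ B 0])
     (use assms in auto)

lemma abs_continuous_on_add:
  assumes "abs_continuous_on S f" "abs_continuous_on S g"
  shows "abs_continuous_on S (\<lambda>x. f x + g x)"
proof (rule abs_continuous_on_dominated[OF assms, of _ 1 1])
  fix u v
  show "\<bar>f v + g v - (f u + g u)\<bar> \<le> 1 * \<bar>f v - f u\<bar> + 1 * \<bar>g v - g u\<bar>"
    using abs_triangle_ineq[of "f v - f u" "g v - g u"] by (simp add: algebra_simps)
qed

lemma abs_continuous_on_imp_continuous_on:
  assumes "abs_continuous_on {a..b} f"
  shows "continuous_on {a..b} f"
  unfolding continuous_on_iff
proof (intro ballI allI impI)
  fix x e assume x: "x \<in> {a..b}" and "0 < (e::real)"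
  obtain d where d: "0 < d" "\<forall>\<D>. \<D> division_of \<Union>\<D> \<and> \<Union>\<D> \<subseteq> {a..b} \<and> (\<Sum>K\<in>\<D>. Sup K - Inf K) < d \<longrightarrow>
       (\<Sum>K\<in>\<D>. \<bar>f (Sup K) - f (Inf K)\<bar>) < e"
    using assms[unfolded abs_continuous_on_def, rule_format, OF \<open>0 < e\<close>] by (elim exE conjE)
  \<comment> \<open>A single interval is already a division, so the definition yields one
    \<open>d\<close> for the whole interval.\<close>
  have *: "\<bar>f v - f u\<bar> < e" if "u \<le> v" "u \<in> {a..b}" "v \<in> {a..b}" "v - u < d" for u v
    using d(2)[rule_format, of "{{u..v}}"] that division_of_self[of u v] by auto
  show "\<exists>d>0. \<forall>x'\<in>{a..b}. dist x' x < d \<longrightarrow> dist (f x') (f x) < e"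
  proof (intro exI[of _ d] conjI ballI impI)
    fix y assume "y \<in> {a..b}" "dist y x < d"
    then show "dist (f y) (f x) < e"
      using *[of x y] *[of y x] x by (cases "x \<le> y") (auto simp: dist_real_def abs_minus_commute)
  qed (rule d)
qed

text \<open>Absolutely continuous factors are continuous, hence bounded on the compact interval;
  these bounds are the domination constants.\<close>

lemma abs_continuous_on_mult:
  assumes f: "abs_continuous_on {a..b} f" and g: "abs_continuous_on {a..b} g"
  shows "abs_continuous_on {a..b} (\<lambda>x. f x * g x)"
proof -
  have "bounded (f ` {a..b})" "bounded (g ` {a..b})"
    using assms by (auto intro!: compact_imp_bounded compact_continuous_image abs_continuous_on_imp_continuous_on)
  then obtain B C where B: "\<And>x. x \<in> {a..b} \<Longrightarrow> \<bar>f x\<bar> \<le> B" and C: "\<And>x. x \<in> {a..b} \<Longrightarrow> \<bar>g x\<bar> \<le> C"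
    by (metis bounded_iff imageI real_norm_def)
  show ?thesis
  proof (rule abs_continuous_on_dominated[OF f g, of _ C B])
    fix u v assume uv: "u \<in> {a..b}" "v \<in> {a..b}"
    have "f v * g v - f u * g u = g v * (f v - f u) + f u * (g v - g u)"
      by (simp add: algebra_simps)
    also have "\<bar>\<dots>\<bar> \<le> \<bar>g v\<bar> * \<bar>f v - f u\<bar> + \<bar>f u\<bar> * \<bar>g v - g u\<bar>"
      using abs_triangle_ineq[of "g v * (f v - f u)" "f u * (g v - g u)"] by (simp only: abs_mult)
    also have "\<dots> \<le> C * \<bar>f v - f u\<bar> + B * \<bar>g v - g u\<bar>"
      by (intro add_mono mult_right_mono B C uv) auto
    finally show "\<bar>f v * g v - f u * g u\<bar> \<le> C * \<bar>f v - f u\<bar> + B * \<bar>g v - g u\<bar>" .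
  qed
qed

lemma abs_continuous_on_C1:
  fixes f :: "real \<Rightarrow> real"
  assumes f: "\<And>t. t \<in> {a..b} \<Longrightarrow> (f has_real_derivative f' t) (at t within {a..b})"
    and f': "continuous_on {a..b} f'"
  shows "abs_continuous_on {a..b} f"
proof -
  have "bounded (f' ` {a..b})"
    using f' by (auto intro!: compact_imp_bounded compact_continuous_image)
  then obtain B where B: "\<And>x. x \<in> {a..b} \<Longrightarrow> \<bar>f' x\<bar> \<le> B"
    by (metis bounded_iff imageI real_norm_def)
  show ?thesis
  proof (rule abs_continuous_on_Lipschitz)
    fix u v assume uv: "u \<in> {a..b}" "v \<in> {a..b}"
    show "\<bar>f v - f u\<bar> \<le> B * \<bar>v - u\<bar>"
      using field_differentiable_bound[of "{a..b}" f f' B v u] f B uv by auto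
  qed
qed

section \<open>Lebesgue's fundamental theorem of calculus\<close>

text \<open>Outer regularity: \<open>U - N\<close> has measure below \<open>e\<close>, and the null
  set \<open>N\<close> adds nothing to it.\<close>

lemma negligible_outer_open:
  fixes N :: "real set"
  assumes "negligible N" "0 < e"
  obtains U where "open U" "N \<subseteq> U" "U \<in> lmeasurable" "measure lebesgue U < e"
proof -
  obtain U where U: "open U" "N \<subseteq> U" "U - N \<in> lmeasurable" "emeasure lebesgue (U - N) < ennreal e"
    using sets_lebesgue_outer_open[OF negligible_imp_sets[OF assms(1)] assms(2)] by blast
  have eq: "(U - N) \<union> N = U" using U by auto
  have "U \<in> lmeasurable"
    using fmeasurable.Un[OF U(3) negligible_imp_measurable[OF assms(1)]] eq by simp
  moreover have "measure lebesgue U = measure lebesgue (U - N)"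
    using measure_Diff_null_set[of U lebesgue N] assms(1) \<open>U \<in> lmeasurable\<close>
    by (simp add: negligible_iff_null_sets fmeasurableD)
  moreover have "measure lebesgue (U - N) < e"
    using U(3,4) \<open>0 < e\<close> by (simp add: emeasure_eq_measure2 ennreal_less_iff)
  ultimately show thesis using U that by simp
qed

text \<open>
  The gauge sends tags in the exceptional set \<open>N\<close> into an open set of small measure, where absolute
  continuity controls the increments of \<open>f\<close>; elsewhere it is dictated by differentiability.
\<close>

lemma has_integral_abs_continuous_on:
  fixes f :: "real \<Rightarrow> real"
  assumes "a \<le> b" and ac: "abs_continuous_on {a..b} f" and N: "negligible N"
    and f': "\<And>x. x \<in> {a..b} - N \<Longrightarrow> (f has_real_derivative f' x) (at x within {a..b})"
  shows "(f' has_integral f b - f a) {a..b}"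
proof -
  \<comment> \<open>Setting the derivative to 0 on \<open>N\<close> leaves only increments of
    \<open>f\<close> in the Riemann terms tagged there; the change is undone at the end by a spike
    argument.\<close>
  define g where "g x = (if x \<in> N then 0 else f' x)" for x
  have "(g has_integral f b - f a) (cbox a b)"
    unfolding has_integral
  proof (intro allI impI)
    fix e :: real assume "0 < e"
    \<comment> \<open>The tolerance is spread over the length so that the tags outside
      \<open>N\<close> use up at most \<open>e / 2\<close>; the 1 covers
      \<open>a = b\<close>.\<close>
    define e' where "e' = e / (2 * (b - a + 1))"
    have "0 < e'" and e'_le: "e' * (b - a) \<le> e / 2"
      using \<open>0 < e\<close> \<open>a \<le> b\<close> by (auto simp: e'_def field_simps)
    have "\<forall>x. \<exists>d>0. x \<in> {a..b} - N \<longrightarrow>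
         (\<forall>y\<in>{a..b}. \<bar>y - x\<bar> < d \<longrightarrow> \<bar>f y - f x - f' x * (y - x)\<bar> \<le> e' * \<bar>y - x\<bar>)"
    proof
      fix x show "\<exists>d>0. x \<in> {a..b} - N \<longrightarrow>
         (\<forall>y\<in>{a..b}. \<bar>y - x\<bar> < d \<longrightarrow> \<bar>f y - f x - f' x * (y - x)\<bar> \<le> e' * \<bar>y - x\<bar>)"
      proof (cases "x \<in> {a..b} - N")
        case True
        then have "\<forall>e>0. \<exists>d>0. \<forall>y\<in>{a..b}. \<bar>y - x\<bar> < d \<longrightarrow> \<bar>f y - f x - f' x * (y - x)\<bar> \<le> e * \<bar>y - x\<bar>"
          using f'[OF True] by (simp add: has_field_derivative_def has_derivative_within_alt)
        then show ?thesis
          using \<open>0 < e'\<close> by meson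
      qed (auto intro: exI[of _ 1])
    qed
    then obtain d where d: "\<And>x. 0 < d x"
      "\<And>x y. \<lbrakk>x \<in> {a..b} - N; y \<in> {a..b}; \<bar>y - x\<bar> < d x\<rbrakk> \<Longrightarrow> \<bar>f y - f x - f' x * (y - x)\<bar> \<le> e' * \<bar>y - x\<bar>"
      by metis
    obtain \<delta> where \<delta>: "0 < \<delta>" "\<forall>\<D>. \<D> division_of \<Union>\<D> \<and> \<Union>\<D> \<subseteq> {a..b} \<and> (\<Sum>K\<in>\<D>. Sup K - Inf K) < \<delta> \<longrightarrow>
       (\<Sum>K\<in>\<D>. \<bar>f (Sup K) - f (Inf K)\<bar>) < e / 2"
      using ac[unfolded abs_continuous_on_def, rule_format, OF half_gt_zero, OF \<open>0 < e\<close>] by (elim exE conjE)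
    obtain U where U: "open U" "N \<subseteq> U" "U \<in> lmeasurable" "measure lebesgue U < \<delta>"
      using negligible_outer_open[OF N \<delta>(1)] .
    define \<gamma> where "\<gamma> x = (if x \<in> N then U else ball x (d x))" for x
    show "\<exists>\<gamma>. gauge \<gamma> \<and> (\<forall>\<D>. \<D> tagged_division_of cbox a b \<and> \<gamma> fine \<D> \<longrightarrow>
                norm ((\<Sum>(x, k)\<in>\<D>. measure lborel k *\<^sub>R g x) - (f b - f a)) < e)"
    proof (intro exI[of _ \<gamma>] conjI allI impI)
      show "gauge \<gamma>"
        using U d(1) by (auto simp: \<gamma>_def gauge_def)
    next
      fix p assume "p tagged_division_of cbox a b \<and> \<gamma> fine p"
      then have p: "p tagged_division_of cbox a b" and fine: "\<gamma> fine p" by auto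
      have fin: "finite p" using p by (rule tagged_division_of_finite)
      have pK: "x \<in> K \<and> K \<subseteq> {a..b} \<and> K = {Inf K..Sup K} \<and> Inf K \<le> Sup K \<and> K \<subseteq> \<gamma> x \<and> measure lborel K = Sup K - Inf K"
        if xK: "(x, K) \<in> p" for x K
      proof -
        have K: "x \<in> K" "K \<subseteq> {a..b}" using tagged_division_ofD(2,3)[OF p xK] by auto
        obtain u v where uv: "K = {u..v}" using tagged_division_ofD(4)[OF p xK] by auto
        then have "u \<le> v" using K by auto
        then have "Inf K = u" "Sup K = v" using uv by simp_all
        then show ?thesis using K uv \<open>u \<le> v\<close> fineD[OF fine xK] by simp
      qed
      have diff: "f b - f a = (\<Sum>(x, K)\<in>p. f (Sup K) - f (Inf K))" "b - a = (\<Sum>(x, K)\<in>p. Sup K - Inf K)"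
        using additive_tagged_division_1[where f=f, OF \<open>a \<le> b\<close>] additive_tagged_division_1[where f="\<lambda>x. x", OF \<open>a \<le> b\<close>] p by auto
      define q where "q = {t \<in> p. fst t \<in> N}"
      have "q \<subseteq> p" by (auto simp: q_def)
      define h where "h = (\<lambda>(x, K). measure lborel K * g x - (f (Sup K) - f (Inf K)))"
      have "(\<Sum>(x, k)\<in>p. measure lborel k *\<^sub>R g x) - (f b - f a) = sum h p"
        by (simp add: diff(1) h_def split_def sum_subtractf)
      also have "\<dots> = sum h (p - q) + sum h q"
        using sum.subset_diff[OF \<open>q \<subseteq> p\<close> fin] .
      finally have eq: "(\<Sum>(x, k)\<in>p. measure lborel k *\<^sub>R g x) - (f b - f a) = sum h (p - q) + sum h q" .
      have "\<bar>sum h (p - q)\<bar> \<le> (\<Sum>(x, K)\<in>p - q. e' * (Sup K - Inf K))"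
      proof (rule order_trans[OF sum_abs], rule sum_mono, clarify)
        fix x K assume xK: "(x, K) \<in> p" "(x, K) \<notin> q"
        then have xN: "x \<notin> N" by (auto simp: q_def)
        define u v where "u = Inf K" and "v = Sup K"
        have "K = {u..v}" "x \<in> K" "u \<le> v" "K \<subseteq> {a..b}" "K \<subseteq> ball x (d x)"
          using pK[OF xK(1)] xN by (simp_all add: u_def v_def \<gamma>_def)
        then have K: "x \<in> {a..b}" "u \<in> {a..b}" "v \<in> {a..b}" "u \<le> x" "x \<le> v" "{u..v} \<subseteq> ball x (d x)"
          by auto
        have "u \<in> ball x (d x)" "v \<in> ball x (d x)"
          using K(4,5) by (auto intro!: subsetD[OF K(6)] simp del: mem_ball)
        then have du: "\<bar>u - x\<bar> < d x" and dv: "\<bar>v - x\<bar> < d x"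
          by (auto simp: dist_real_def abs_minus_commute)
        have xN': "x \<in> {a..b} - N" using K(1) xN by blast
        have "\<bar>f u - f x - f' x * (u - x)\<bar> \<le> e' * \<bar>u - x\<bar>" "\<bar>f v - f x - f' x * (v - x)\<bar> \<le> e' * \<bar>v - x\<bar>"
          using d(2)[OF xN' K(2) du] d(2)[OF xN' K(3) dv] by blast+
        \<comment> \<open>Straddle estimate: the tag lies between the endpoints, so the errors at
          the two ends, proportional to their distances from \<open>x\<close>, add up to a multiple
          of \<open>v - u\<close>.\<close>
        moreover have "(v - u) * f' x - (f v - f u)
            = (f u - f x - f' x * (u - x)) - (f v - f x - f' x * (v - x))"
          by (simp add: algebra_simps)
        moreover have "e' * \<bar>u - x\<bar> + e' * \<bar>v - x\<bar> = e' * (v - u)"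
          using K by (simp add: algebra_simps)
        ultimately have "\<bar>(v - u) * f' x - (f v - f u)\<bar> \<le> e' * (v - u)"
          by linarith
        then show "\<bar>h (x, K)\<bar> \<le> e' * (Sup K - Inf K)"
          using pK[OF xK(1)] xN by (simp add: h_def u_def v_def g_def)
      qed
      also have "\<dots> \<le> (\<Sum>(x, K)\<in>p. e' * (Sup K - Inf K))"
      proof (rule sum_mono2[OF fin])
        fix t assume "t \<in> p - (p - q)"
        then have "(fst t, snd t) \<in> p" by simp
        from pK[OF this] show "0 \<le> (case t of (x, K) \<Rightarrow> e' * (Sup K - Inf K))"
          using \<open>0 < e'\<close> by (simp add: split_def)
      qed blast
      also have "\<dots> = e' * (b - a)"
        by (simp add: diff(2) sum_distrib_left split_def)
      finally have 1: "\<bar>sum h (p - q)\<bar> \<le> e / 2" using e'_le by linarith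
      have q: "q tagged_partial_division_of cbox a b"
        by (rule tagged_partial_division_subset[OF _ \<open>q \<subseteq> p\<close>]) (use p in \<open>simp add: tagged_division_of_def\<close>)
      note qD = partial_division_of_tagged_division[OF q]
      have "\<bar>sum h q\<bar> \<le> (\<Sum>(x, K)\<in>q. \<bar>f (Sup K) - f (Inf K)\<bar>)"
        by (rule order_trans[OF sum_abs], rule sum_mono) (auto simp: h_def g_def q_def abs_minus_commute)
      \<comment> \<open>The guard prepares the passage from tagged pairs to bare intervals: that
        rule wants a summand vanishing on every interval with empty interior, including the empty
        one, where \<open>Sup\<close> and \<open>Inf\<close> mean nothing.\<close>
      also have "\<dots> = (\<Sum>(x, K)\<in>q. if K = {} then 0 else \<bar>f (Sup K) - f (Inf K)\<bar>)"
      proof (rule sum.cong[OF refl])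
        fix t assume "t \<in> q"
        then have "(fst t, snd t) \<in> p" using \<open>q \<subseteq> p\<close> by auto
        from pK[OF this] show "(case t of (x, K) \<Rightarrow> \<bar>f (Sup K) - f (Inf K)\<bar>)
            = (case t of (x, K) \<Rightarrow> if K = {} then 0 else \<bar>f (Sup K) - f (Inf K)\<bar>)"
          by (auto simp: split_def)
      qed
      also have "\<dots> = (\<Sum>K\<in>snd ` q. if K = {} then 0 else \<bar>f (Sup K) - f (Inf K)\<bar>)"
      proof (rule sum.over_tagged_division_lemma[OF tagged_partial_division_of_Union_self[OF q]])
        fix u v :: real assume "box u v = {}"
        then have "v \<le> u" by simp
        then show "(if cbox u v = {} then 0 else \<bar>f (Sup (cbox u v)) - f (Inf (cbox u v))\<bar>) = 0"
          by (cases "u = v") auto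
      qed
      also have "\<dots> = (\<Sum>K\<in>snd ` q. \<bar>f (Sup K) - f (Inf K)\<bar>)"
      proof (rule sum.cong[OF refl])
        fix K assume "K \<in> snd ` q"
        then obtain x where "(x, K) \<in> p" using \<open>q \<subseteq> p\<close> by auto
        from pK[OF this] show "(if K = {} then 0 else \<bar>f (Sup K) - f (Inf K)\<bar>) = \<bar>f (Sup K) - f (Inf K)\<bar>"
          by auto
      qed
      also have "\<dots> < e / 2"
      proof (rule \<delta>(2)[rule_format], intro conjI)
        show "\<Union>(snd ` q) \<subseteq> {a..b}"
        proof (rule UN_least)
          fix t assume "t \<in> q"
          then have "(fst t, snd t) \<in> p" using \<open>q \<subseteq> p\<close> by auto
          from pK[OF this] show "snd t \<subseteq> {a..b}" by blast
        qed
        \<comment> \<open>The intervals do not overlap, so their lengths add up to the measure of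
          the union, which lies in \<open>U\<close> because all their tags lie in
          \<open>N\<close>.\<close>
        have "(\<Sum>K\<in>snd ` q. Sup K - Inf K) = (\<Sum>K\<in>snd ` q. measure lebesgue K)"
        proof (rule sum.cong[OF refl])
          fix K assume "K \<in> snd ` q"
          then obtain x where "(x, K) \<in> p" using \<open>q \<subseteq> p\<close> by auto
          from pK[OF this] show "Sup K - Inf K = measure lebesgue K"
            by (metis measure_completion sets_lborel borel_closed closed_atLeastAtMost)
        qed
        also have "\<dots> = measure lebesgue (\<Union>(snd ` q))"
          by (rule content_division[OF qD])
        also have "\<dots> \<le> measure lebesgue U"
        proof (rule measure_mono_fmeasurable)
          show "\<Union>(snd ` q) \<subseteq> U"
          proof (rule UN_least)
            fix t assume "t \<in> q"
            then have "(fst t, snd t) \<in> p" and "fst t \<in> N" by (auto simp: q_def)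
            with pK[OF this(1)] show "snd t \<subseteq> U" by (simp add: \<gamma>_def)
          qed
          show "\<Union>(snd ` q) \<in> sets lebesgue"
            using lmeasurable_division[OF qD] by blast
        qed (rule U)
        finally show "(\<Sum>K\<in>snd ` q. Sup K - Inf K) < \<delta>" using U by linarith
      qed (rule qD)
      finally have "\<bar>sum h q\<bar> < e / 2" .
      with 1 show "norm ((\<Sum>(x, k)\<in>p. measure lborel k *\<^sub>R g x) - (f b - f a)) < e"
        unfolding eq by simp
    qed
  qed
  then have "(g has_integral f b - f a) {a..b}" by simp
  then show ?thesis
    by (rule has_integral_spike[OF N, rotated]) (auto simp: g_def)
qed

text \<open>Truncation at height \<open>n\<close>: the bounded part contributes at most
  \<open>n\<close> times the total length, and by dominated convergence the remainder has small
  integral over all of \<open>{a..b}\<close>, wherever the intervals are placed.\<close>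

lemma abs_continuous_on_indefinite_integral:
  fixes f :: "real \<Rightarrow> real"
  assumes f: "f absolutely_integrable_on {a..b}"
  shows "abs_continuous_on {a..b} (\<lambda>t. integral {a..t} f)"
  unfolding abs_continuous_on_def
proof (intro allI impI)
  fix e :: real assume "0 < e"
  define g where "g n x = min \<bar>f x\<bar> (real n)" for n x
  have abs: "(\<lambda>x. \<bar>f x\<bar>) absolutely_integrable_on {a..b}"
    using set_integrable_abs[OF f] .
  have g: "g n absolutely_integrable_on {a..b}" for n
    unfolding g_def using absolutely_integrable_min_1[OF abs, of "\<lambda>x. real n"] by simp
  have "(\<lambda>n. integral {a..b} (g n)) \<longlonglongrightarrow> integral {a..b} (\<lambda>x. \<bar>f x\<bar>)"
  proof (rule dominated_convergence(2)[of g _ "\<lambda>x. \<bar>f x\<bar>"])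
    show "g n integrable_on {a..b}" for n
      using g absolutely_integrable_on_def by blast
    show "(\<lambda>x. \<bar>f x\<bar>) integrable_on {a..b}"
      using abs absolutely_integrable_on_def by blast
    show "norm (g n x) \<le> \<bar>f x\<bar>" for n x by (simp add: g_def)
    show "(\<lambda>n. g n x) \<longlonglongrightarrow> \<bar>f x\<bar>" for x
    proof (rule tendsto_eventually)
      obtain m where "\<bar>f x\<bar> \<le> real m" using real_arch_simple by blast
      then show "\<forall>\<^sub>F n in sequentially. g n x = \<bar>f x\<bar>"
        by (intro eventually_sequentiallyI[of m]) (simp add: g_def)
    qed
  qed
  then obtain n where n: "\<bar>integral {a..b} (g n) - integral {a..b} (\<lambda>x. \<bar>f x\<bar>)\<bar> < e / 2"
    using LIMSEQ_D[of _ _ "e/2"] \<open>0 < e\<close> by force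
  \<comment> \<open>\<open>f\<close> is bounded by \<open>n\<close> up to a remainder \<open>r\<close> of small integral\<close>
  define r where "r x = \<bar>f x\<bar> - g n x" for x
  have r: "r integrable_on {a..b}" "\<And>x. 0 \<le> r x"
    unfolding r_def using abs g[of n] by (auto intro!: integrable_diff simp: absolutely_integrable_on_def g_def)
  have "integral {a..b} r = integral {a..b} (\<lambda>x. \<bar>f x\<bar>) - integral {a..b} (g n)"
    unfolding r_def using abs g[of n]
    by (intro Henstock_Kurzweil_Integration.integral_diff) (auto simp: absolutely_integrable_on_def)
  then have r_small: "integral {a..b} r < e / 2"
    using n by linarith
  have le: "\<bar>f x\<bar> \<le> real n + r x" for x by (simp add: r_def g_def)
  show "\<exists>\<delta>>0. \<forall>\<D>. \<D> division_of \<Union>\<D> \<and> \<Union>\<D> \<subseteq> {a..b} \<and> (\<Sum>K\<in>\<D>. Sup K - Inf K) < \<delta> \<longrightarrow>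
        (\<Sum>K\<in>\<D>. \<bar>integral {a..Sup K} f - integral {a..Inf K} f\<bar>) < e"
  \<comment> \<open>With this length the bounded part stays within \<open>e / 2\<close>; adding 1
    avoids division by zero when \<open>n = 0\<close>.\<close>
  proof (intro exI[of _ "e / (2 * (real n + 1))"] conjI allI impI)
    fix \<D> assume *: "\<D> division_of \<Union>\<D> \<and> \<Union>\<D> \<subseteq> {a..b} \<and> (\<Sum>K\<in>\<D>. Sup K - Inf K) < e / (2 * (real n + 1))"
    then have D: "\<D> division_of \<Union>\<D>" "\<Union>\<D> \<subseteq> {a..b}" by auto
    have "(\<Sum>K\<in>\<D>. \<bar>integral {a..Sup K} f - integral {a..Inf K} f\<bar>)
       \<le> (\<Sum>K\<in>\<D>. real n * (Sup K - Inf K) + integral K r)"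
    proof (rule sum_mono)
      fix K assume "K \<in> \<D>"
      define u v where "u = Inf K" and "v = Sup K"
      have K: "K = {u..v}" "u \<le> v" "K \<subseteq> {a..b}"
        using division_of_real_bounds(1,2)[OF D(1) \<open>K \<in> \<D>\<close>] D(2) \<open>K \<in> \<D>\<close> by (auto simp: u_def v_def)
      then have uv: "a \<le> u" "v \<le> b" by auto
      have fi: "f integrable_on {a..b}" using f absolutely_integrable_on_def by blast
      have "integral {a..v} f - integral {a..u} f = integral {u..v} f"
        using Henstock_Kurzweil_Integration.integral_combine[of a u v f] uv K integrable_subinterval_real[OF fi, of a v] by simp
      also have "\<bar>\<dots>\<bar> \<le> integral {u..v} (\<lambda>x. real n + r x)"
      proof -
        have "f integrable_on {u..v}" "(\<lambda>x. real n + r x) integrable_on {u..v}"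
          using integrable_subinterval_real[OF fi, of u v] integrable_subinterval_real[OF r(1), of u v] K
          by (auto intro!: integrable_add)
        then show ?thesis
          using integral_norm_bound_integral[of f "{u..v}" "\<lambda>x. real n + r x"] le by simp
      qed
      also have "\<dots> = real n * (v - u) + integral {u..v} r"
        using integrable_subinterval_real[OF r(1), of u v] K
        by (subst Henstock_Kurzweil_Integration.integral_add) auto
      finally show "\<bar>integral {a..Sup K} f - integral {a..Inf K} f\<bar> \<le> real n * (Sup K - Inf K) + integral K r"
        unfolding u_def[symmetric] v_def[symmetric] K(1)[symmetric] .
    qed
    also have "\<dots> = real n * (\<Sum>K\<in>\<D>. Sup K - Inf K) + integral (\<Union>\<D>) r"
      using integral_combine_division_topdown[OF integrable_on_subdivision[OF D(1) r(1) D(2)] D(1)]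
      by (simp add: sum.distrib sum_distrib_left)
    also have "\<dots> \<le> real n * (e / (2 * (real n + 1))) + integral {a..b} r"
      using * r by (intro add_mono mult_left_mono integral_subset_le integrable_on_subdivision[OF D(1) r(1) D(2)]) auto
    also have "\<dots> < e"
    proof -
      have "real n * (e / (2 * (real n + 1))) \<le> e / 2"
        using \<open>0 < e\<close> by (simp add: field_simps)
      then show ?thesis using r_small by linarith
    qed
    finally show "(\<Sum>K\<in>\<D>. \<bar>integral {a..Sup K} f - integral {a..Inf K} f\<bar>) < e" .
  qed (use \<open>0 < e\<close> in auto)
qed

text \<open>Carries the exceptional set of a reflected function back to the original
  variable.\<close>

lemma negligible_uminus_image:
  fixes S :: "real set"
  assumes "negligible S"
  shows "negligible (uminus ` S)"
  unfolding negligible_def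
proof (intro allI)
  fix a b :: real
  have eq: "indicat_real (uminus ` S) = (\<lambda>x. indicator S (- x))"
  proof
    fix x
    have "x \<in> uminus ` S \<longleftrightarrow> - x \<in> S"
      by (metis image_iff minus_minus)
    then show "indicat_real (uminus ` S) x = indicator S (- x)"
      by (simp add: indicator_def)
  qed
  have "(indicat_real S has_integral 0) {- b..- a}"
    using assms unfolding negligible_def by (metis box_real(2))
  then have "((\<lambda>x. indicat_real S (- x)) has_integral 0) {- (- a)..- (- b)}"
    by (rule has_integral_reflect_lemma_real)
  then show "(indicat_real (uminus ` S) has_integral 0) (cbox a b)"
    by (simp add: eq)
qed

text \<open>
  The library provides the right derivative almost everywhere; applying it to the reflected
  function yields the left one.
\<close>

lemma indefinite_integral_has_real_derivative_ae:
  fixes f :: "real \<Rightarrow> real"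
  assumes f: "f integrable_on {a..b}"
  obtains N where "negligible N"
    "\<And>x. x \<in> {a..b} - N \<Longrightarrow> ((\<lambda>t. integral {a..t} f) has_real_derivative f x) (at x within {a..b})"
proof -
  \<comment> \<open>Extension by zero gives integrability on every interval, so difference quotients
    may reach beyond \<open>{a..b}\<close>.\<close>
  define g where "g x = (if x \<in> {a..b} then f x else 0)" for x
  have "g integrable_on UNIV"
    unfolding g_def using f by (simp only: integrable_restrict_UNIV)
  then have gi: "g integrable_on cbox c d" for c d
    using integrable_on_subcbox by blast
  then have gi': "(\<lambda>x. g (- x)) integrable_on cbox c d" for c d
    using gi[of "- d" "- c"] integrable_reflect[of g "- c" "- d"] by simp
  obtain N1 where N1: "negligible N1" "\<And>x e. \<lbrakk>x \<notin> N1; 0 < e\<rbrakk> \<Longrightarrow>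
      \<exists>d>0. \<forall>h. 0 < h \<and> h < d \<longrightarrow> \<bar>integral {x..x + h} g / h - g x\<bar> < e"
    using integrable_ccontinuous_explicit[OF gi] by (auto simp: field_simps)
  obtain N2 where N2: "negligible N2" "\<And>x e. \<lbrakk>x \<notin> N2; 0 < e\<rbrakk> \<Longrightarrow>
      \<exists>d>0. \<forall>h. 0 < h \<and> h < d \<longrightarrow> \<bar>integral {x..x + h} (\<lambda>x. g (- x)) / h - g (- x)\<bar> < e"
    using integrable_ccontinuous_explicit[OF gi'] by (auto simp: field_simps)
  define N where "N = N1 \<union> uminus ` N2"
  have "negligible N"
    unfolding N_def using N1(1) N2(1) by (intro negligible_Un negligible_uminus_image)
  moreover have "((\<lambda>t. integral {a..t} f) has_real_derivative f x) (at x within {a..b})"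
    if x: "x \<in> {a..b} - N" for x
  proof -
    have fg: "integral {c..d} f = integral {c..d} g" if "a \<le> c" "d \<le> b" for c d
      using that by (intro Henstock_Kurzweil_Integration.integral_cong) (auto simp: g_def)
    have comb: "integral {a..d} f - integral {a..c} f = integral {c..d} g" if "a \<le> c" "c \<le> d" "d \<le> b" for c d
      using Henstock_Kurzweil_Integration.integral_combine[of a c d f] that fg[of c d]
        integrable_subinterval_real[OF f, of a d] by simp
    have gx: "g x = f x" using x by (simp add: g_def)
    have x1: "x \<notin> N1" and x2: "- x \<notin> N2" using x by (force simp: N_def)+
    show ?thesis
      unfolding has_field_derivative_iff Lim_within
    proof (intro allI impI)
      fix e :: real assume "0 < e"
      obtain d1 where d1: "d1 > 0" "\<And>h. 0 < h \<Longrightarrow> h < d1 \<Longrightarrow> \<bar>integral {x..x + h} g / h - g x\<bar> < e"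
        using N1(2)[OF x1 \<open>0 < e\<close>] by blast
      obtain d2 where d2: "d2 > 0" "\<And>h. 0 < h \<Longrightarrow> h < d2 \<Longrightarrow> \<bar>integral {- x..- x + h} (\<lambda>x. g (- x)) / h - g x\<bar> < e"
        using N2(2)[OF x2 \<open>0 < e\<close>] by auto
      have "dist ((integral {a..y} f - integral {a..x} f) / (y - x)) (f x) < e"
        if y: "y \<in> {a..b}" "y \<noteq> x" "\<bar>y - x\<bar> < min d1 d2" for y
      proof (cases "x < y")
        case True
        then show ?thesis
          using d1(2)[of "y - x"] y x comb[of x y] by (simp add: dist_real_def gx)
      next
        case False
        then have "y < x" using y by simp
        \<comment> \<open>A left difference quotient at \<open>x\<close> is a right one of the
          reflected function at \<open>- x\<close>.\<close>
        have "integral {- x..- y} (\<lambda>x. g (- x)) = integral {y..x} g"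
          using Henstock_Kurzweil_Integration.integral_reflect_real[of x y g] by simp
        then have "\<bar>integral {y..x} g / (x - y) - f x\<bar> < e"
          using d2(2)[of "x - y"] y \<open>y < x\<close> by (simp add: gx)
        moreover have "(integral {a..y} f - integral {a..x} f) / (y - x) = integral {y..x} g / (x - y)"
          using comb[of y x] y x \<open>y < x\<close> by (simp add: field_simps)
        ultimately show ?thesis by (simp add: dist_real_def)
      qed
      then show "\<exists>d>0. \<forall>y\<in>{a..b}. 0 < dist y x \<and> dist y x < d \<longrightarrow>
          dist ((integral {a..y} f - integral {a..x} f) / (y - x)) (f x) < e"
        using d1 d2 by (intro exI[of _ "min d1 d2"]) (auto simp: dist_real_def)
    qed
  qed
  ultimately show thesis by (rule that)
qed

section \<open>Absolutely continuous primitives\<close>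

lemma AE_lebesgue_on_iff_negligible:
  assumes "S \<in> sets lebesgue"
  shows "(AE t in lebesgue_on S. P t) \<longleftrightarrow> (\<exists>N. negligible N \<and> (\<forall>t\<in>S - N. P t))"
proof -
  have "(AE t in lebesgue_on S. P t) \<longleftrightarrow> (AE t in lebesgue. t \<in> S \<longrightarrow> P t)"
    using assms by (simp add: AE_restrict_space_iff)
  also have "\<dots> \<longleftrightarrow> (\<exists>N. negligible N \<and> {t. \<not> (t \<in> S \<longrightarrow> P t)} \<subseteq> N)"
    by (rule eventually_ae_filter_negligible)
  also have "\<dots> \<longleftrightarrow> (\<exists>N. negligible N \<and> (\<forall>t\<in>S - N. P t))"
    by (rule ex_cong1) blast
  finally show ?thesis .
qed

text \<open>Hides the exceptional null set, so that the rules of calculus combine without mentioning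
  it; only the almost-everywhere values of \<open>f'\<close> matter.\<close>

definition ac_primitive :: "real \<Rightarrow> real \<Rightarrow> (real \<Rightarrow> real) \<Rightarrow> (real \<Rightarrow> real) \<Rightarrow> bool" where
  "ac_primitive a b f f' \<longleftrightarrow> abs_continuous_on {a..b} f \<and>
     (\<exists>N. negligible N \<and> (\<forall>x\<in>{a..b} - N. (f has_real_derivative f' x) (at x within {a..b})))"

lemma ac_primitive_C1:
  assumes "\<And>t. t \<in> {a..b} \<Longrightarrow> (f has_real_derivative f' t) (at t within {a..b})"
    and "continuous_on {a..b} f'"
  shows "ac_primitive a b f f'"
  unfolding ac_primitive_def
proof
  show "abs_continuous_on {a..b} f" by (rule abs_continuous_on_C1[OF assms])
  show "\<exists>N. negligible N \<and> (\<forall>x\<in>{a..b} - N. (f has_real_derivative f' x) (at x within {a..b}))"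
    using assms(1) by (intro exI[of _ "{}"]) simp
qed

lemma ac_primitive_integral:
  assumes "f absolutely_integrable_on {a..b}"
  shows "ac_primitive a b (\<lambda>t. integral {a..t} f) f"
proof -
  have "f integrable_on {a..b}" using assms by (simp add: absolutely_integrable_on_def)
  then obtain N where "negligible N"
    "\<And>x. x \<in> {a..b} - N \<Longrightarrow> ((\<lambda>t. integral {a..t} f) has_real_derivative f x) (at x within {a..b})"
    using indefinite_integral_has_real_derivative_ae by blast
  then show ?thesis
    unfolding ac_primitive_def using abs_continuous_on_indefinite_integral[OF assms] by blast
qed

lemma ac_primitive_cong:
  assumes "ac_primitive a b f f'" and "\<And>t. t \<in> {a..b} \<Longrightarrow> f' t = g' t"
  shows "ac_primitive a b f g'"
  using assms unfolding ac_primitive_def by (metis DiffD1)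

lemma ac_primitive_transform:
  assumes "ac_primitive a b f f'" and eq: "\<And>t. t \<in> {a..b} \<Longrightarrow> f t = g t"
  shows "ac_primitive a b g f'"
proof -
  obtain N where N: "negligible N" "\<forall>x\<in>{a..b} - N. (f has_real_derivative f' x) (at x within {a..b})"
    and ac: "abs_continuous_on {a..b} f"
    using assms(1) unfolding ac_primitive_def by blast
  have "abs_continuous_on {a..b} g"
    by (rule abs_continuous_on_dominated[OF ac ac, of _ 1 0]) (simp add: eq[symmetric])
  moreover have "(g has_real_derivative f' x) (at x within {a..b})" if "x \<in> {a..b} - N" for x
    by (rule has_field_derivative_transform_within[OF N(2)[rule_format, OF that] zero_less_one])
       (use that eq in auto)
  ultimately show ?thesis
    unfolding ac_primitive_def using N(1) by blast
qed

lemma ac_primitive_add: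
  assumes "ac_primitive a b f f'" "ac_primitive a b g g'"
  shows "ac_primitive a b (\<lambda>t. f t + g t) (\<lambda>t. f' t + g' t)"
proof -
  obtain N1 N2 where N: "negligible N1" "negligible N2"
    "\<forall>x\<in>{a..b} - N1. (f has_real_derivative f' x) (at x within {a..b})"
    "\<forall>x\<in>{a..b} - N2. (g has_real_derivative g' x) (at x within {a..b})"
    using assms unfolding ac_primitive_def by blast
  have "\<forall>x\<in>{a..b} - (N1 \<union> N2). ((\<lambda>t. f t + g t) has_real_derivative f' x + g' x) (at x within {a..b})"
    using N(3,4) by (auto intro!: DERIV_add)
  then show ?thesis
    unfolding ac_primitive_def
    using assms N(1,2) by (metis abs_continuous_on_add ac_primitive_def negligible_Un)
qed

lemma ac_primitive_mult:
  assumes "ac_primitive a b f f'" "ac_primitive a b g g'"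
  shows "ac_primitive a b (\<lambda>t. f t * g t) (\<lambda>t. f' t * g t + g' t * f t)"
proof -
  obtain N1 N2 where N: "negligible N1" "negligible N2"
    "\<forall>x\<in>{a..b} - N1. (f has_real_derivative f' x) (at x within {a..b})"
    "\<forall>x\<in>{a..b} - N2. (g has_real_derivative g' x) (at x within {a..b})"
    using assms unfolding ac_primitive_def by blast
  have "\<forall>x\<in>{a..b} - (N1 \<union> N2). ((\<lambda>t. f t * g t) has_real_derivative f' x * g x + g' x * f x) (at x within {a..b})"
    using N(3,4) by (auto intro!: DERIV_mult)
  then show ?thesis
    unfolding ac_primitive_def
    using assms N(1,2) by (metis abs_continuous_on_mult ac_primitive_def negligible_Un)
qed

lemma ac_primitive_cmult:
  assumes "ac_primitive a b f f'"
  shows "ac_primitive a b (\<lambda>t. k * f t) (\<lambda>t. k * f' t)"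
proof -
  have "ac_primitive a b (\<lambda>t. k) (\<lambda>t. 0)"
    by (rule ac_primitive_C1) auto
  from ac_primitive_mult[OF this assms] show ?thesis
    by (simp add: mult.commute)
qed

lemma ac_primitive_diff:
  assumes "ac_primitive a b f f'" "ac_primitive a b g g'"
  shows "ac_primitive a b (\<lambda>t. f t - g t) (\<lambda>t. f' t - g' t)"
  using ac_primitive_add[OF assms(1) ac_primitive_cmult[OF assms(2), of "-1"]] by simp

lemma ac_primitive_imp_continuous_on: "ac_primitive a b f f' \<Longrightarrow> continuous_on {a..b} f"
  unfolding ac_primitive_def using abs_continuous_on_imp_continuous_on by blast

lemma abs_continuous_on_subset: "abs_continuous_on S f \<Longrightarrow> S' \<subseteq> S \<Longrightarrow> abs_continuous_on S' f"
  unfolding abs_continuous_on_def by (meson subset_trans)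

lemma ac_primitive_has_integral:
  assumes "ac_primitive a b f f'" "t \<in> {a..b}"
  shows "(f' has_integral f t - f a) {a..t}"
proof -
  obtain N where N: "negligible N" "\<forall>x\<in>{a..b} - N. (f has_real_derivative f' x) (at x within {a..b})"
    and ac: "abs_continuous_on {a..b} f"
    using assms(1) unfolding ac_primitive_def by blast
  have sub: "{a..t} \<subseteq> {a..b}" using assms(2) by auto
  show ?thesis
  proof (rule has_integral_abs_continuous_on[OF _ abs_continuous_on_subset[OF ac sub] N(1)])
    show "(f has_real_derivative f' x) (at x within {a..t})" if "x \<in> {a..t} - N" for x
      using N(2) that sub by (blast intro: DERIV_subset)
  qed (use assms(2) in simp)
qed

text \<open>Regularity gain: \<open>f\<close> is the integral of its almost-everywhere derivative,
  and when that is continuous the classical fundamental theorem differentiates the integral at every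
  point.\<close>

lemma ac_primitive_has_real_derivative:
  assumes "ac_primitive a b f f'" "continuous_on {a..b} f'" "t \<in> {a..b}"
  shows "(f has_real_derivative f' t) (at t within {a..b})"
proof -
  have "((\<lambda>u. f a + integral {a..u} f') has_real_derivative f' t) (at t within {a..b})"
    using integral_has_real_derivative[OF assms(2,3)] by (auto intro!: derivative_eq_intros)
  then show ?thesis
  proof (rule has_field_derivative_transform_within[OF _ zero_less_one assms(3)])
    show "f a + integral {a..u} f' = f u" if "u \<in> {a..b}" for u
      using integral_unique[OF ac_primitive_has_integral[OF assms(1) that]] by simp
  qed
qed

section \<open>Both problems restated through primitives, and integrability of kernels\<close>

lemma reflection_solution_iff:
  "reflection_solution T a b h x \<longleftrightarrow>
     ac_primitive (-T) T x (\<lambda>t. h t - a * x (- t) - b * x t) \<and> x (- T) = x T"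
proof -
  have "(\<exists>x'. (x has_real_derivative x') (at t within {-T..T}) \<and> x' + a * x (-t) + b * x t = h t)
      \<longleftrightarrow> (x has_real_derivative h t - a * x (- t) - b * x t) (at t within {-T..T})" (is "?L \<longleftrightarrow> ?R") for t
  proof
    assume ?L
    then obtain x' where x': "(x has_real_derivative x') (at t within {-T..T})" "x' + a * x (-t) + b * x t = h t"
      by blast
    then have "x' = h t - a * x (- t) - b * x t" by simp
    with x' show ?R by simp
  next
    assume ?R then show ?L by (intro exI) auto
  qed
  then show ?thesis
    unfolding reflection_solution_def ac_primitive_def
    by (simp add: AE_lebesgue_on_iff_negligible)
qed

lemma periodic_solution_iff:
  "periodic_solution T c f x \<longleftrightarrow>
     (\<exists>y. (\<forall>t\<in>{-T..T}. (x has_real_derivative y t) (at t within {-T..T})) \<and>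
          ac_primitive (-T) T y (\<lambda>t. f t - c * x t) \<and> x (- T) = x T \<and> y (- T) = y T)"
proof -
  have "(\<exists>y'. (y has_real_derivative y') (at t within {-T..T}) \<and> y' + c * x t = f t)
      \<longleftrightarrow> (y has_real_derivative f t - c * x t) (at t within {-T..T})" (is "?L \<longleftrightarrow> ?R") for t y
  proof
    assume ?L
    then obtain y' where y': "(y has_real_derivative y') (at t within {-T..T})" "y' + c * x t = f t"
      by blast
    then have "y' = f t - c * x t" by simp
    with y' show ?R by simp
  next
    assume ?R then show ?L by (intro exI) auto
  qed
  then show ?thesis
    unfolding periodic_solution_def ac_primitive_def
    by (simp add: AE_lebesgue_on_iff_negligible conj_assoc)
qed

lemma continuous_mult_absolutely_integrable:
  fixes f :: "real \<Rightarrow> real"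
  assumes "integrable (lebesgue_on {a..b}) f" "continuous_on {a..b} \<phi>"
  shows "(\<lambda>s. \<phi> s * f s) absolutely_integrable_on {a..b}"
proof (rule absolutely_integrable_bounded_measurable_product_real)
  show "\<phi> \<in> borel_measurable (lebesgue_on {a..b})"
    by (rule continuous_imp_measurable_on_sets_lebesgue[OF assms(2)]) simp
  show "bounded (\<phi> ` {a..b})"
    using assms(2) by (auto intro!: compact_imp_bounded compact_continuous_image)
  show "f absolutely_integrable_on {a..b}"
    using assms(1) by (simp add: set_integrable_def integrable_restrict_space)
qed simp

text \<open>Treats kernels that are cut off at the diagonal. Absolute integrability survives because
  taking the norm commutes with the cut-off.\<close>

lemma causal_absolutely_integrable:
  fixes g :: "real \<Rightarrow> real"
  assumes "g absolutely_integrable_on {a..b}" "t \<in> {a..b}"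
  shows "((\<lambda>s. if s \<le> t then g s else 0) has_integral integral {a..t} g) {a..b}"
    and "(\<lambda>s. if s \<le> t then g s else 0) absolutely_integrable_on {a..b}"
proof -
  have sub: "{a..t} \<subseteq> {a..b}" using assms(2) by auto
  have *: "((\<lambda>s. if s \<le> t then f s else 0) has_integral integral {a..t} f) {a..b}"
    if "f integrable_on {a..b}" for f :: "real \<Rightarrow> real"
  proof -
    have "(f has_integral integral {a..t} f) {a..t}"
      using integrable_subinterval_real[OF that sub] by (rule integrable_integral)
    then have "((\<lambda>s. if s \<in> {a..t} then f s else 0) has_integral integral {a..t} f) {a..b}"
      using has_integral_restrict[OF sub] by blast
    then show ?thesis
      by (rule has_integral_eq[rotated]) auto
  qed
  show 1: "((\<lambda>s. if s \<le> t then g s else 0) has_integral integral {a..t} g) {a..b}"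
    using assms(1) by (intro *) (simp add: absolutely_integrable_on_def)
  have "((\<lambda>s. if s \<le> t then norm (g s) else 0) has_integral integral {a..t} (\<lambda>s. norm (g s))) {a..b}"
    using assms(1) by (intro *) (simp add: absolutely_integrable_on_def)
  moreover have "(\<lambda>s. if s \<le> t then norm (g s) else 0) = (\<lambda>s. norm (if s \<le> t then g s else 0))"
    by auto
  ultimately show "(\<lambda>s. if s \<le> t then g s else 0) absolutely_integrable_on {a..b}"
    unfolding absolutely_integrable_on_def using 1 by (metis has_integral_integrable)
qed

section \<open>The equation y'' + c y = 0 and its Green's function\<close>

definition gcos :: "real \<Rightarrow> real \<Rightarrow> real" where
  "gcos c t = (if 0 < c then cos (sqrt c * t) else cosh (sqrt (- c) * t))"

text \<open>Division by \<open>sqrt (- c)\<close> would give 0 at \<open>c = 0\<close>, so the limit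
  \<open>t\<close> is a case of its own; in \<open>gcos\<close> the hyperbolic branch already gives
  the correct constant 1.\<close>

definition gsin :: "real \<Rightarrow> real \<Rightarrow> real" where
  "gsin c t = (if 0 < c then sin (sqrt c * t) / sqrt c
               else if c = 0 then t else sinh (sqrt (- c) * t) / sqrt (- c))"

text \<open>
  \<^term>\<open>gcos c\<close> and \<^term>\<open>gsin c\<close> solve \<open>y'' + c y = 0\<close> with \<open>(y, y')(0)\<close> equal to \<open>(1, 0)\<close> and \<open>(0, 1)\<close>,
  so one set of addition formulas serves both signs of \<open>c\<close>.
\<close>

lemma gcos_0 [simp]: "gcos c 0 = 1" and gsin_0 [simp]: "gsin c 0 = 0"
  by (auto simp: gcos_def gsin_def)

lemma gcos_minus [simp]: "gcos c (- t) = gcos c t" and gsin_minus [simp]: "gsin c (- t) = - gsin c t"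
  by (auto simp: gcos_def gsin_def)

lemma gcos_add: "gcos c (s + t) = gcos c s * gcos c t - c * gsin c s * gsin c t"
proof (cases c "0 :: real" rule: linorder_cases)
  case less
  then have "c = - (sqrt (- c) * sqrt (- c))" by simp
  with less show ?thesis
    by (simp add: gcos_def gsin_def cosh_add distrib_left)
next
  case greater
  then have "c = sqrt c * sqrt c" by simp
  with greater show ?thesis
    by (simp add: gcos_def gsin_def cos_add distrib_left)
qed (simp add: gcos_def)

lemma gsin_add: "gsin c (s + t) = gsin c s * gcos c t + gcos c s * gsin c t"
  by (auto simp: gcos_def gsin_def cosh_add sinh_add sin_add cos_add distrib_left add_divide_distrib)

lemma gcos_diff: "gcos c (s - t) = gcos c s * gcos c t + c * gsin c s * gsin c t"
  and gsin_diff: "gsin c (s - t) = gsin c s * gcos c t - gcos c s * gsin c t"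
  using gcos_add[of c s "- t"] gsin_add[of c s "- t"] by simp_all

lemma gcos_gsin_squared: "gcos c t * gcos c t + c * gsin c t * gsin c t = 1"
  using gcos_diff[of c t t] by simp

lemma DERIV_gcos: "(gcos c has_real_derivative - c * gsin c t) (at t)"
proof (cases c "0 :: real" rule: linorder_cases)
  case less
  define r where "r = sqrt (- c)"
  have r: "r \<noteq> 0" "- c = r * r" using less by (simp_all add: r_def)
  have "((\<lambda>t. cosh (sqrt (- c) * t)) has_real_derivative sqrt (- c) * sinh (sqrt (- c) * t)) (at t)"
    by (auto intro!: derivative_eq_intros)
  moreover have gsin: "gsin c t = sinh (r * t) / r"
    using less by (simp add: gsin_def r_def)
  have "- c * gsin c t = r * sinh (r * t)"
    unfolding gsin r(2) using r(1) by simp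
  then have "sqrt (- c) * sinh (sqrt (- c) * t) = - c * gsin c t"
    by (simp add: r_def)
  ultimately show ?thesis using less by (simp add: gcos_def[abs_def])
next
  case greater
  have "((\<lambda>t. cos (sqrt c * t)) has_real_derivative - (sqrt c * sin (sqrt c * t))) (at t)"
    by (auto intro!: derivative_eq_intros)
  moreover have "- (sqrt c * sin (sqrt c * t)) = - c * gsin c t"
    using greater by (simp add: gsin_def field_simps)
  ultimately show ?thesis using greater by (simp add: gcos_def[abs_def])
qed (simp add: gcos_def[abs_def])

lemma DERIV_gsin: "(gsin c has_real_derivative gcos c t) (at t)"
proof (cases c "0 :: real" rule: linorder_cases)
  case less
  have "((\<lambda>t. sinh (r * t) / r) has_real_derivative cosh (r * t)) (at t)" if "r \<noteq> 0" for r :: real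
    using that by (auto intro!: derivative_eq_intros)
  then have "((\<lambda>t. sinh (sqrt (- c) * t) / sqrt (- c)) has_real_derivative cosh (sqrt (- c) * t)) (at t)"
    using less by simp
  then show ?thesis using less by (simp add: gcos_def gsin_def[abs_def])
next
  case greater
  have "((\<lambda>t. sin (r * t) / r) has_real_derivative cos (r * t)) (at t)" if "r \<noteq> 0" for r :: real
    using that by (auto intro!: derivative_eq_intros)
  then have "((\<lambda>t. sin (sqrt c * t) / sqrt c) has_real_derivative cos (sqrt c * t)) (at t)"
    using greater by simp
  then show ?thesis using greater by (simp add: gcos_def gsin_def[abs_def])
qed (simp add: gcos_def gsin_def[abs_def])

lemmas gcos_derivative [derivative_intros] = DERIV_chain2[OF DERIV_gcos]
lemmas gsin_derivative [derivative_intros] = DERIV_chain2[OF DERIV_gsin]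

lemma continuous_on_gcos [continuous_intros]:
    "continuous_on A f \<Longrightarrow> continuous_on A (\<lambda>x. gcos c (f x))"
  and continuous_on_gsin [continuous_intros]:
    "continuous_on A f \<Longrightarrow> continuous_on A (\<lambda>x. gsin c (f x))"
proof -
  have "continuous_on UNIV (gcos c)" "continuous_on UNIV (gsin c)"
    using DERIV_gcos DERIV_gsin by (blast intro: continuous_at_imp_continuous_on DERIV_isCont)+
  then show "continuous_on A f \<Longrightarrow> continuous_on A (\<lambda>x. gcos c (f x))"
    "continuous_on A f \<Longrightarrow> continuous_on A (\<lambda>x. gsin c (f x))"
    by (auto intro: continuous_on_compose2)
qed

text \<open>Absence of resonance without a case split: for \<open>c > 0\<close> the last assumption
  says that \<open>sqrt c * T\<close> is no multiple of \<open>pi\<close>, for \<open>c < 0\<close>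
  it is the positivity of \<open>sinh\<close> on positive arguments.\<close>

locale nonresonant =
  fixes T c :: real
  assumes T_pos: "0 < T" and c_nz: "c \<noteq> 0" and gsin_nz: "gsin c T \<noteq> 0"
begin

lemma gcos_double: "gcos c (T + T) = 1 - 2 * c * gsin c T * gsin c T"
  using gcos_gsin_squared[of c T] unfolding gcos_add by linarith

text \<open>Every solution is \<open>gcos c t * p + gsin c t * q\<close>. Comparing the two ends,
  even terms cancel and odd terms must vanish: \<open>z\<close> gives \<open>q = 0\<close> and
  \<open>w\<close> gives \<open>p = 0\<close>.\<close>

lemma periodic_homogeneous_zero:
  assumes z: "\<And>t. t \<in> {-T..T} \<Longrightarrow> (z has_real_derivative w t) (at t within {-T..T})"
    and w: "\<And>t. t \<in> {-T..T} \<Longrightarrow> (w has_real_derivative - c * z t) (at t within {-T..T})"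
    and per: "z (- T) = z T" "w (- T) = w T" and t: "t \<in> {-T..T}"
  shows "z t = 0"
proof -
  let ?C = "gcos c" and ?S = "gsin c"
  have C': "(?C has_real_derivative - c * ?S t) (at t within A)"
    and S': "(?S has_real_derivative ?C t) (at t within A)" for t A
    using DERIV_gcos DERIV_gsin by (auto intro: has_field_derivative_at_within)
  \<comment> \<open>two first integrals of the equation, from which \<open>z\<close> and \<open>w\<close> are recovered linearly\<close>
  obtain p where p: "\<And>t. t \<in> {-T..T} \<Longrightarrow> ?C t * z t - ?S t * w t = p"
  proof -
    have "((\<lambda>t. ?C t * z t - ?S t * w t) has_real_derivative 0) (at t within {-T..T})" if "t \<in> {-T..T}" for t
      by (rule DERIV_cong[OF DERIV_diff[OF DERIV_mult[OF C' z[OF that]] DERIV_mult[OF S' w[OF that]]]])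
         (simp add: algebra_simps)
    then show thesis
      using has_field_derivative_zero_constant[of "{-T..T}" "\<lambda>t. ?C t * z t - ?S t * w t"] that by auto
  qed
  obtain q where q: "\<And>t. t \<in> {-T..T} \<Longrightarrow> c * (?S t * z t) + ?C t * w t = q"
  proof -
    have "((\<lambda>t. c * (?S t * z t) + ?C t * w t) has_real_derivative 0) (at t within {-T..T})" if "t \<in> {-T..T}" for t
      by (rule DERIV_cong[OF DERIV_add[OF DERIV_cmult[OF DERIV_mult[OF S' z[OF that]]] DERIV_mult[OF C' w[OF that]]]])
         (simp add: algebra_simps)
    then show thesis
      using has_field_derivative_zero_constant[of "{-T..T}" "\<lambda>t. c * (?S t * z t) + ?C t * w t"] that by auto
  qed
  have zt: "z t = ?C t * p + ?S t * q" if "t \<in> {-T..T}" for t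
  proof -
    have "?C t * p + ?S t * q = (?C t * ?C t + c * ?S t * ?S t) * z t"
      unfolding p[OF that, symmetric] q[OF that, symmetric] by (simp add: algebra_simps)
    then show ?thesis by (simp add: gcos_gsin_squared)
  qed
  have wt: "w t = ?C t * q - c * ?S t * p" if "t \<in> {-T..T}" for t
  proof -
    have "?C t * q - c * ?S t * p = (?C t * ?C t + c * ?S t * ?S t) * w t"
      unfolding p[OF that, symmetric] q[OF that, symmetric] by (simp add: algebra_simps)
    then show ?thesis by (simp add: gcos_gsin_squared)
  qed
  have T: "T \<in> {-T..T}" "- T \<in> {-T..T}" using T_pos by auto
  have "q = 0" using per(1) zt[OF T(1)] zt[OF T(2)] gsin_nz by simp
  moreover have "p = 0" using per(2) wt[OF T(1)] wt[OF T(2)] gsin_nz c_nz by simp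
  ultimately show ?thesis using zt[OF t] by simp
qed

text \<open>Chosen so that the \<open>t\<close>-derivative of the kernel jumps by 1 across the
  diagonal, where its one-sided slopes are \<open>c * gsin c T * K\<close> and the negative of
  that.\<close>

definition K :: real where "K = 1 / (2 * c * gsin c T)"

lemma K: "2 * c * gsin c T * K = 1"
  using c_nz gsin_nz by (simp add: K_def)

definition green :: "real \<Rightarrow> real \<Rightarrow> real" where
  "green t s = K * gcos c (T - \<bar>t - s\<bar>)"

text \<open>The \<open>t\<close>-derivative of the split form of \<open>green\<close> given below.
  On the diagonal it takes the limit from \<open>t > s\<close>, a choice invisible to integrals over
  \<open>s\<close>.\<close>

definition green' :: "real \<Rightarrow> real \<Rightarrow> real" where
  "green' t s = (if s \<le> t then gcos c (t - s) else 0) - c * K * gsin c (T + t - s)"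

text \<open>Splits off the causal fundamental solution, leaving a kernel that is smooth across the diagonal.\<close>

lemma green_eq: "green t s = (if s \<le> t then gsin c (t - s) else 0) + K * gcos c (T + t - s)"
proof (cases "s \<le> t")
  case True
  define r where "r = t - s"
  have "K * gcos c (T - r) - K * gcos c (T + r) = (2 * c * gsin c T * K) * gsin c r"
    by (simp add: gcos_diff gcos_add algebra_simps)
  then have eq: "K * gcos c (T - r) = gsin c r + K * gcos c (T + r)"
    unfolding K by simp
  have r: "\<bar>r\<bar> = r" "T + t - s = T + r" "t - s = r" using True by (simp_all add: r_def)
  show ?thesis unfolding green_def r eq using True by simp
next
  case False
  then have eq: "T - \<bar>t - s\<bar> = T + t - s" by simp
  show ?thesis unfolding green_def eq using False by simp
qed

lemma green_has_derivative:
  assumes "t \<noteq> s"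
  shows "((\<lambda>r. green r s) has_real_derivative green' t s) (at t)"
proof (cases "s < t")
  case True
  have "((\<lambda>r. gsin c (r - s) + K * gcos c (T + r - s)) has_real_derivative green' t s) (at t)"
    using True by (auto intro!: derivative_eq_intros simp: green'_def)
  then show ?thesis
    by (rule has_field_derivative_transform_within_open[of _ _ _ "{s<..}"]) (use True in \<open>auto simp: green_eq\<close>)
next
  case False
  have "((\<lambda>r. K * gcos c (T + r - s)) has_real_derivative green' t s) (at t)"
    using False assms by (auto intro!: derivative_eq_intros simp: green'_def)
  then show ?thesis
    by (rule has_field_derivative_transform_within_open[of _ _ _ "{..<s}"]) (use False assms in \<open>auto simp: green_eq\<close>)
qed

lemma continuous_on_green: "continuous_on A (\<lambda>(t, s). green t s)"
  unfolding green_def split_def by (intro continuous_intros)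

section \<open>Solution by variation of constants\<close>

text \<open>The addition formulas separate \<open>t\<close> from \<open>s\<close> in the kernel, so
  every convolution with it reduces to this moment and \<open>sin_moment\<close>.\<close>

definition cos_moment :: "(real \<Rightarrow> real) \<Rightarrow> real \<Rightarrow> real" where
  "cos_moment f t = integral {-T..t} (\<lambda>s. gcos c s * f s)"

definition sin_moment :: "(real \<Rightarrow> real) \<Rightarrow> real \<Rightarrow> real" where
  "sin_moment f t = integral {-T..t} (\<lambda>s. gsin c s * f s)"

text \<open>Closed form of the integral of \<open>green t s * f s\<close> over \<open>s\<close>:
  first the causal part, then the smooth part, whose moments are taken over the whole
  interval.\<close>

definition sol :: "(real \<Rightarrow> real) \<Rightarrow> real \<Rightarrow> real" where
  "sol f t = gsin c t * cos_moment f t - gcos c t * sin_moment f t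
     + K * (gcos c (T + t) * cos_moment f T + c * gsin c (T + t) * sin_moment f T)"

definition sol' :: "(real \<Rightarrow> real) \<Rightarrow> real \<Rightarrow> real" where
  "sol' f t = gcos c t * cos_moment f t + c * gsin c t * sin_moment f t
     + K * (- c * gsin c (T + t) * cos_moment f T + c * gcos c (T + t) * sin_moment f T)"

context
  fixes f :: "real \<Rightarrow> real"
  assumes f: "integrable (lebesgue_on {-T..T}) f"
begin

lemma moment_absolutely_integrable:
  "(\<lambda>s. gcos c s * f s) absolutely_integrable_on {-T..T}"
  "(\<lambda>s. gsin c s * f s) absolutely_integrable_on {-T..T}"
  using f by (auto intro!: continuous_mult_absolutely_integrable continuous_intros)

lemma moment_has_integral:
  assumes "t \<in> {-T..T}"
  shows "((\<lambda>s. gcos c s * f s) has_integral cos_moment f t) {-T..t}"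
    and "((\<lambda>s. gsin c s * f s) has_integral sin_moment f t) {-T..t}"
proof -
  have "{-T..t} \<subseteq> {-T..T}" using assms by auto
  then show "((\<lambda>s. gcos c s * f s) has_integral cos_moment f t) {-T..t}"
    "((\<lambda>s. gsin c s * f s) has_integral sin_moment f t) {-T..t}"
    unfolding cos_moment_def sin_moment_def
    using moment_absolutely_integrable unfolding absolutely_integrable_on_def
    by (blast intro: integrable_integral integrable_subinterval_real)+
qed

text \<open>The shift \<open>r\<close> is independent of the upper limit so that this and
  \<open>gcos_convolution\<close> serve both the causal part (\<open>r = t\<close>) and the smooth
  part (limit \<open>T\<close>, \<open>r = T + t\<close>).\<close>

lemma gsin_convolution:
  assumes "t \<in> {-T..T}"
  shows "integral {-T..t} (\<lambda>s. gsin c (r - s) * f s) = gsin c r * cos_moment f t - gcos c r * sin_moment f t"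
proof (rule integral_unique)
  have "((\<lambda>s. gsin c r * (gcos c s * f s) - gcos c r * (gsin c s * f s)) has_integral
      gsin c r * cos_moment f t - gcos c r * sin_moment f t) {-T..t}"
    by (intro has_integral_diff has_integral_mult_right moment_has_integral assms)
  then show "((\<lambda>s. gsin c (r - s) * f s) has_integral
      gsin c r * cos_moment f t - gcos c r * sin_moment f t) {-T..t}"
    by (simp add: gsin_diff algebra_simps)
qed

lemma gcos_convolution:
  assumes "t \<in> {-T..T}"
  shows "integral {-T..t} (\<lambda>s. gcos c (r - s) * f s) = gcos c r * cos_moment f t + c * gsin c r * sin_moment f t"
proof (rule integral_unique)
  have "((\<lambda>s. gcos c r * (gcos c s * f s) + c * gsin c r * (gsin c s * f s)) has_integral
      gcos c r * cos_moment f t + c * gsin c r * sin_moment f t) {-T..t}"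
    by (intro has_integral_add has_integral_mult_right moment_has_integral assms)
  then show "((\<lambda>s. gcos c (r - s) * f s) has_integral
      gcos c r * cos_moment f t + c * gsin c r * sin_moment f t) {-T..t}"
    by (simp add: gcos_diff algebra_simps)
qed

lemma
  assumes t: "t \<in> {-T..T}"
  shows green_absolutely_integrable: "(\<lambda>s. green t s * f s) absolutely_integrable_on {-T..T}"
    and green_has_integral: "((\<lambda>s. green t s * f s) has_integral sol f t) {-T..T}"
proof -
  have T: "T \<in> {-T..T}" using T_pos by simp
  have 1: "(\<lambda>s. gsin c (t - s) * f s) absolutely_integrable_on {-T..T}"
    and 2: "(\<lambda>s. K * gcos c (T + t - s) * f s) absolutely_integrable_on {-T..T}"
    using f by (auto intro!: continuous_mult_absolutely_integrable continuous_intros)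
  have eq: "(\<lambda>s. green t s * f s) = (\<lambda>s. (if s \<le> t then gsin c (t - s) * f s else 0) + K * gcos c (T + t - s) * f s)"
    by (auto simp: green_eq algebra_simps)
  show "(\<lambda>s. green t s * f s) absolutely_integrable_on {-T..T}"
    unfolding eq by (intro set_integral_add(1) causal_absolutely_integrable(2) 1 2 t)
  have "((\<lambda>s. K * gcos c (T + t - s) * f s) has_integral integral {-T..T} (\<lambda>s. K * gcos c (T + t - s) * f s)) {-T..T}"
    using 2 by (simp add: absolutely_integrable_on_def integrable_integral)
  moreover have "integral {-T..T} (\<lambda>s. K * gcos c (T + t - s) * f s)
      = K * (gcos c (T + t) * cos_moment f T + c * gsin c (T + t) * sin_moment f T)"
    using gcos_convolution[OF T, of "T + t"] by (simp add: mult.assoc)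
  ultimately show "((\<lambda>s. green t s * f s) has_integral sol f t) {-T..T}"
    unfolding eq sol_def
    using has_integral_add[OF causal_absolutely_integrable(1)[OF 1 t]]
    by (simp add: gsin_convolution[OF t])
qed

lemma
  assumes t: "t \<in> {-T..T}"
  shows green'_absolutely_integrable: "(\<lambda>s. green' t s * f s) absolutely_integrable_on {-T..T}"
    and green'_has_integral: "((\<lambda>s. green' t s * f s) has_integral sol' f t) {-T..T}"
proof -
  have T: "T \<in> {-T..T}" using T_pos by simp
  have 1: "(\<lambda>s. gcos c (t - s) * f s) absolutely_integrable_on {-T..T}"
    and 2: "(\<lambda>s. - c * K * gsin c (T + t - s) * f s) absolutely_integrable_on {-T..T}"
    by (intro continuous_mult_absolutely_integrable f continuous_intros)+
  have eq: "(\<lambda>s. green' t s * f s) = (\<lambda>s. (if s \<le> t then gcos c (t - s) * f s else 0) + - c * K * gsin c (T + t - s) * f s)"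
    by (auto simp: green'_def algebra_simps)
  show "(\<lambda>s. green' t s * f s) absolutely_integrable_on {-T..T}"
    unfolding eq by (intro set_integral_add(1) causal_absolutely_integrable(2) 1 2 t)
  have "((\<lambda>s. - c * K * gsin c (T + t - s) * f s) has_integral integral {-T..T} (\<lambda>s. - c * K * gsin c (T + t - s) * f s)) {-T..T}"
    using 2 unfolding absolutely_integrable_on_def by (blast intro: integrable_integral)
  moreover have "integral {-T..T} (\<lambda>s. - c * K * gsin c (T + t - s) * f s)
      = (- c * K) * (gsin c (T + t) * cos_moment f T - gcos c (T + t) * sin_moment f T)"
    unfolding gsin_convolution[OF T, of "T + t", symmetric] mult.assoc integral_mult_right ..
  ultimately have "((\<lambda>s. - c * K * gsin c (T + t - s) * f s) has_integral
      (- c * K) * (gsin c (T + t) * cos_moment f T - gcos c (T + t) * sin_moment f T)) {-T..T}"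
    by (simp only:)
  then have "((\<lambda>s. green' t s * f s) has_integral
      (gcos c t * cos_moment f t + c * gsin c t * sin_moment f t) +
      (- c * K) * (gsin c (T + t) * cos_moment f T - gcos c (T + t) * sin_moment f T)) {-T..T}"
    unfolding eq gcos_convolution[OF t, symmetric]
    by (rule has_integral_add[OF causal_absolutely_integrable(1)[OF 1 t]])
  also have "(gcos c t * cos_moment f t + c * gsin c t * sin_moment f t) +
      (- c * K) * (gsin c (T + t) * cos_moment f T - gcos c (T + t) * sin_moment f T) = sol' f t"
    by (simp add: sol'_def algebra_simps)
  finally show "((\<lambda>s. green' t s * f s) has_integral sol' f t) {-T..T}" .
qed

lemma ac_primitive_moments:
  "ac_primitive (- T) T (cos_moment f) (\<lambda>s. gcos c s * f s)"
  "ac_primitive (- T) T (sin_moment f) (\<lambda>s. gsin c s * f s)"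
  unfolding cos_moment_def[abs_def] sin_moment_def[abs_def]
  by (intro ac_primitive_integral moment_absolutely_integrable)+

lemma ac_primitive_gcos: "ac_primitive a b (gcos c) (\<lambda>t. - c * gsin c t)"
  and ac_primitive_gsin: "ac_primitive a b (gsin c) (gcos c)"
  using DERIV_gcos DERIV_gsin
  by (auto intro!: ac_primitive_C1 continuous_intros intro: has_field_derivative_at_within simp del: minus_mult_left)

text \<open>The terms from differentiating the moments are \<open>gsin c t * gcos c t * f t\<close>
  with opposite signs and cancel.\<close>

lemma ac_primitive_sol: "ac_primitive (- T) T (sol f) (sol' f)"
proof -
  have "ac_primitive (- T) T (\<lambda>t. K * (gcos c (T + t) * cos_moment f T + c * gsin c (T + t) * sin_moment f T))
    (\<lambda>t. K * (- c * gsin c (T + t) * cos_moment f T + c * gcos c (T + t) * sin_moment f T))"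
    by (rule ac_primitive_C1) (auto intro!: derivative_eq_intros continuous_intros)
  from ac_primitive_add[OF ac_primitive_diff[OF ac_primitive_mult[OF ac_primitive_gsin ac_primitive_moments(1)]
      ac_primitive_mult[OF ac_primitive_gcos ac_primitive_moments(2)]] this]
  have "ac_primitive (- T) T (sol f) (\<lambda>t. gcos c t * cos_moment f t + gcos c t * f t * gsin c t -
         (- c * gsin c t * sin_moment f t + gsin c t * f t * gcos c t) +
         K * (- c * gsin c (T + t) * cos_moment f T + c * gcos c (T + t) * sin_moment f T))"
    unfolding sol_def[abs_def] .
  then show ?thesis
    by (rule ac_primitive_cong) (simp add: sol'_def)
qed

text \<open>Here the terms from the moments add up instead, to \<open>f t\<close> times the
  quadratic form in \<open>gcos\<close> and \<open>gsin\<close> that equals 1; this supplies the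
  inhomogeneity.\<close>

lemma ac_primitive_sol': "ac_primitive (- T) T (sol' f) (\<lambda>t. f t - c * sol f t)"
proof -
  have "ac_primitive (- T) T (\<lambda>t. K * (- c * gsin c (T + t) * cos_moment f T + c * gcos c (T + t) * sin_moment f T))
    (\<lambda>t. K * (- c * gcos c (T + t) * cos_moment f T + c * (- c * gsin c (T + t)) * sin_moment f T))"
    by (rule ac_primitive_C1) (auto intro!: derivative_eq_intros continuous_intros)
  from ac_primitive_add[OF ac_primitive_add[OF ac_primitive_mult[OF ac_primitive_gcos ac_primitive_moments(1)]
      ac_primitive_cmult[OF ac_primitive_mult[OF ac_primitive_gsin ac_primitive_moments(2)], of c]] this]
  have "ac_primitive (- T) T (sol' f) (\<lambda>t. - c * gsin c t * cos_moment f t + gcos c t * f t * gcos c t +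
         c * (gcos c t * sin_moment f t + gsin c t * f t * gsin c t) +
         K * (- c * gcos c (T + t) * cos_moment f T + c * (- c * gsin c (T + t)) * sin_moment f T))"
    unfolding sol'_def[abs_def] by (simp only: mult.assoc)
  then show ?thesis
  proof (rule ac_primitive_cong)
    fix t
    have "- c * gsin c t * cos_moment f t + gcos c t * f t * gcos c t +
         c * (gcos c t * sin_moment f t + gsin c t * f t * gsin c t) +
         K * (- c * gcos c (T + t) * cos_moment f T + c * (- c * gsin c (T + t)) * sin_moment f T)
       = (gcos c t * gcos c t + c * gsin c t * gsin c t) * f t - c * sol f t"
      by (simp add: sol_def algebra_simps)
    also have "\<dots> = f t - c * sol f t" by (simp add: gcos_gsin_squared)
    finally show "- c * gsin c t * cos_moment f t + gcos c t * f t * gcos c t +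
         c * (gcos c t * sin_moment f t + gsin c t * f t * gsin c t) +
         K * (- c * gcos c (T + t) * cos_moment f T + c * (- c * gsin c (T + t)) * sin_moment f T)
       = f t - c * sol f t" .
  qed
qed

text \<open>At \<open>- T\<close> both moments and the argument \<open>T + t\<close> vanish; at
  \<open>T\<close> the double-angle formulas bring in the factor
  \<open>2 * c * gsin c T * K\<close>, which is 1, so the ends match.\<close>

lemma sol_periodic: "sol f (- T) = sol f T" "sol' f (- T) = sol' f T"
proof -
  have m: "cos_moment f (- T) = 0" "sin_moment f (- T) = 0"
    by (simp_all add: cos_moment_def sin_moment_def)
  have "sol f T - sol f (- T) = gsin c T * cos_moment f T - gcos c T * sin_moment f T
     + (2 * c * gsin c T * K) * (gcos c T * sin_moment f T - gsin c T * cos_moment f T)"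
    unfolding sol_def m gcos_double gsin_add by (simp add: algebra_simps)
  then show "sol f (- T) = sol f T" unfolding K by simp
  have "sol' f T - sol' f (- T) = gcos c T * cos_moment f T + c * gsin c T * sin_moment f T
     - (2 * c * gsin c T * K) * (gcos c T * cos_moment f T + c * gsin c T * sin_moment f T)"
    unfolding sol'_def m gcos_double gsin_add by (simp add: algebra_simps)
  then show "sol' f (- T) = sol' f T" unfolding K by simp
qed

lemma sol_has_derivative:
  "t \<in> {-T..T} \<Longrightarrow> (sol f has_real_derivative sol' f t) (at t within {-T..T})"
  using ac_primitive_has_real_derivative[OF ac_primitive_sol ac_primitive_imp_continuous_on[OF ac_primitive_sol']] .

end

end

section \<open>The periodic problem and the problem with reflection\<close>

context nonresonant begin

text \<open>In the difference the data \<open>f\<close> cancel, so the difference of the first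
  derivatives has a continuous almost-everywhere derivative and is differentiable everywhere, as the
  homogeneous lemma requires.\<close>

lemma periodic_solution_unique:
  assumes "periodic_solution T c f x1" "periodic_solution T c f x2" "t \<in> {-T..T}"
  shows "x1 t = x2 t"
proof -
  obtain y1 where y1: "\<forall>t\<in>{-T..T}. (x1 has_real_derivative y1 t) (at t within {-T..T})"
    "ac_primitive (-T) T y1 (\<lambda>t. f t - c * x1 t)" "x1 (- T) = x1 T" "y1 (- T) = y1 T"
    using assms(1) unfolding periodic_solution_iff by (elim exE conjE)
  obtain y2 where y2: "\<forall>t\<in>{-T..T}. (x2 has_real_derivative y2 t) (at t within {-T..T})"
    "ac_primitive (-T) T y2 (\<lambda>t. f t - c * x2 t)" "x2 (- T) = x2 T" "y2 (- T) = y2 T"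
    using assms(2) unfolding periodic_solution_iff by (elim exE conjE)
  have z: "((\<lambda>t. x1 t - x2 t) has_real_derivative y1 t - y2 t) (at t within {-T..T})" if "t \<in> {-T..T}" for t
    by (intro DERIV_diff y1(1)[rule_format] y2(1)[rule_format] that)
  have "ac_primitive (-T) T (\<lambda>t. y1 t - y2 t) (\<lambda>t. - c * (x1 t - x2 t))"
    by (rule ac_primitive_cong[OF ac_primitive_diff[OF y1(2) y2(2)]]) (simp add: algebra_simps)
  moreover have "continuous_on {-T..T} (\<lambda>t. x1 t - x2 t)"
    by (rule DERIV_continuous_on) (rule z)
  then have "continuous_on {-T..T} (\<lambda>t. - c * (x1 t - x2 t))"
    by (rule continuous_on_mult_left)
  ultimately have "((\<lambda>t. y1 t - y2 t) has_real_derivative - c * (x1 t - x2 t)) (at t within {-T..T})"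
    if "t \<in> {-T..T}" for t
    using that by (rule ac_primitive_has_real_derivative)
  from periodic_homogeneous_zero[OF z this _ _ assms(3)] show ?thesis
    using y1 y2 by simp
qed

lemma LINT_green:
  assumes "integrable (lebesgue_on {-T..T}) f" "t \<in> {-T..T}"
  shows "(LINT s|lebesgue_on {-T..T}. green t s * f s) = sol f t"
proof -
  have "integrable (lebesgue_on {-T..T}) (\<lambda>s. green t s * f s)"
    by (rule absolutely_integrable_imp_integrable[OF green_absolutely_integrable[OF assms]]) simp
  from has_integral_integral_lebesgue_on[OF this] show ?thesis
    using has_integral_unique[OF _ green_has_integral[OF assms]] by simp
qed

lemma periodic_solution_green:
  assumes "integrable (lebesgue_on {-T..T}) f"
  shows "periodic_solution T c f (\<lambda>t. LINT s|lebesgue_on {-T..T}. green t s * f s)"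
proof -
  let ?x = "\<lambda>t. LINT s|lebesgue_on {-T..T}. green t s * f s"
  have T: "T \<in> {-T..T}" "- T \<in> {-T..T}" using T_pos by auto
  have "(?x has_real_derivative sol' f t) (at t within {-T..T})" if "t \<in> {-T..T}" for t
    by (rule has_field_derivative_transform_within[OF sol_has_derivative[OF assms that] zero_less_one that])
       (simp add: LINT_green[OF assms])
  moreover have "ac_primitive (- T) T (sol' f) (\<lambda>t. f t - c * ?x t)"
    by (rule ac_primitive_cong[OF ac_primitive_sol'[OF assms]]) (simp add: LINT_green[OF assms])
  ultimately show ?thesis
    unfolding periodic_solution_iff
    using sol_periodic[OF assms] by (intro exI[of _ "sol' f"]) (simp add: LINT_green[OF assms T(1)] LINT_green[OF assms T(2)])
qed

lemma periodic_greens_function_green: "periodic_greens_function T c green"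
  unfolding periodic_greens_function_def
proof (intro conjI allI impI ballI)
  fix f x :: "real \<Rightarrow> real" and t
  assume f: "integrable (lebesgue_on {-T..T}) f"
  then show "periodic_solution T c f (\<lambda>t. LINT s|lebesgue_on {-T..T}. green t s * f s)"
    by (rule periodic_solution_green)
  assume "periodic_solution T c f x" "t \<in> {-T..T}"
  then show "x t = (LINT s|lebesgue_on {-T..T}. green t s * f s)"
    by (rule periodic_solution_unique[OF _ periodic_solution_green[OF f]])
qed (rule continuous_on_green)

lemma periodic_greens_function_eq_green:
  assumes G: "periodic_greens_function T c G" and t: "t \<in> {-T..T}" and s: "s \<in> {-T..T}"
  shows "G t s = green t s"
proof -
  define d where "d s = G t s - green t s" for s
  \<comment> \<open>testing against \<open>d\<close> itself gives \<open>\<integral> d\<^sup>2 = 0\<close>\<close>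
  have cG: "continuous_on {-T..T} (G t)"
  proof -
    have "continuous_on ({-T..T} \<times> {-T..T}) (\<lambda>(t, s). G t s)"
      using G[unfolded periodic_greens_function_def] by (rule conjunct1)
    moreover have "continuous_on {-T..T} (Pair t)"
      by (intro continuous_intros)
    moreover have "Pair t ` {-T..T} \<subseteq> {-T..T} \<times> {-T..T}"
      using t by blast
    ultimately have "continuous_on {-T..T} (\<lambda>s. case (t, s) of (t, s) \<Rightarrow> G t s)"
      by (rule continuous_on_compose2)
    then show ?thesis by (simp only: prod.case)
  qed
  have cg: "continuous_on {-T..T} (green t)"
    unfolding green_def[abs_def] by (intro continuous_intros)
  have cd: "continuous_on {-T..T} d"
    unfolding d_def[abs_def] by (intro continuous_intros cG cg)
  have d: "integrable (lebesgue_on {-T..T}) d"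
    by (rule continuous_imp_integrable_real[OF cd])
  \<comment> \<open>\<open>t\<close> stays frozen inside \<open>d\<close>. The solution that
    \<open>green\<close> produces for the data \<open>d\<close> is fed to the uniqueness clause of
    \<open>G\<close>, and the result is read off at this \<open>t\<close>.\<close>
  have "(LINT s|lebesgue_on {-T..T}. green t s * d s) = (LINT s|lebesgue_on {-T..T}. G t s * d s)"
    using G[unfolded periodic_greens_function_def, THEN conjunct2, THEN spec, THEN mp, OF d, THEN conjunct2,
        THEN spec, THEN mp, OF periodic_solution_green[OF d]] t by (rule bspec)
  moreover have "integrable (lebesgue_on {-T..T}) (\<lambda>s. G t s * d s)"
    "integrable (lebesgue_on {-T..T}) (\<lambda>s. green t s * d s)"
    by (intro continuous_imp_integrable_real continuous_intros cG cg cd)+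
  ultimately have "(LINT s|lebesgue_on {-T..T}. G t s * d s - green t s * d s) = 0"
    by simp
  then have "(LINT s|lebesgue_on {-T..T}. d s * d s) = 0"
    by (simp add: d_def algebra_simps)
  moreover have cdd: "continuous_on {-T..T} (\<lambda>s. d s * d s)"
    by (intro continuous_intros cd)
  ultimately have "((\<lambda>s. d s * d s) has_integral 0) {-T..T}"
    using has_integral_integral_lebesgue_on[OF continuous_imp_integrable_real[OF cdd]] by simp
  then have "d s * d s = 0"
    using has_integral_0_cbox_imp_0[of "- T" T "\<lambda>s. d s * d s" s, unfolded box_real, OF cdd] s T_pos
    by (simp only: zero_le_square greaterThanLessThan_empty_iff not_le)
  then show ?thesis by (simp add: d_def)
qed

section \<open>The reflection kernel of an arbitrary Green's function\<close>

context
  fixes G assumes G: "periodic_greens_function T c G"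
begin

lemma periodic_greens_function_has_derivative:
  assumes "t \<in> {-T..T}" "s \<in> {-T..T}" "t \<noteq> s"
  shows "((\<lambda>r. G r s) has_real_derivative green' t s) (at t within {-T..T})"
  by (rule has_field_derivative_transform_within
        [OF has_field_derivative_at_within[OF green_has_derivative[OF assms(3)]] zero_less_one assms(1)])
     (simp add: periodic_greens_function_eq_green[OF G _ assms(2)])

text \<open>On a nondegenerate interval the derivative within it is unique, so the choice made by
  \<open>partial_t\<close> is determined.\<close>

lemma partial_t_eq:
  assumes "t \<in> {-T..T}" "s \<in> {-T..T}" "t \<noteq> s"
  shows "partial_t T G t s = green' t s"
  using vector_derivative_within_cbox[of "- T" T t "\<lambda>r. G r s" "green' t s"] T_pos assms
    periodic_greens_function_has_derivative[OF assms]
  by (simp add: partial_t_def has_real_derivative_iff_has_vector_derivative)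

lemma
  assumes h: "integrable (lebesgue_on {-T..T}) h" and t: "t \<in> {-T..T}"
  shows reflection_kernel_integrable: "integrable (lebesgue_on {-T..T}) (\<lambda>s. reflection_kernel T a b G t s * h s)"
    and LINT_reflection_kernel:
      "(LINT s|lebesgue_on {-T..T}. reflection_kernel T a b G t s * h s) = a * sol h (- t) - b * sol h t + sol' h t"
proof -
  have mt: "- t \<in> {-T..T}" using t by simp
  let ?k = "\<lambda>s. a * (green (- t) s * h s) - b * (green t s * h s) + green' t s * h s"
  \<comment> \<open>The point \<open>s = t\<close>, where \<open>partial_t\<close> is unspecified,
    is negligible and is absorbed by the spike rules below.\<close>
  have eq: "reflection_kernel T a b G t s * h s = ?k s" if "s \<in> {-T..T} - {t}" for s
    using that t mt
    by (simp add: reflection_kernel_def partial_t_eq periodic_greens_function_eq_green[OF G] algebra_simps)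
  have "?k absolutely_integrable_on {-T..T}"
    by (intro set_integral_add(1) set_integral_diff(1) set_integrable_mult_right
        green_absolutely_integrable green'_absolutely_integrable h t mt)
  then have "(\<lambda>s. reflection_kernel T a b G t s * h s) absolutely_integrable_on {-T..T}"
    by (rule absolutely_integrable_spike[of _ _ "{t}"]) (use eq in auto)
  then show int: "integrable (lebesgue_on {-T..T}) (\<lambda>s. reflection_kernel T a b G t s * h s)"
    by (rule absolutely_integrable_imp_integrable) simp
  have "(?k has_integral a * sol h (- t) - b * sol h t + sol' h t) {-T..T}"
    by (intro has_integral_add has_integral_diff has_integral_mult_right
        green_has_integral green'_has_integral h t mt)
  then have "((\<lambda>s. reflection_kernel T a b G t s * h s) has_integral
      a * sol h (- t) - b * sol h t + sol' h t) {-T..T}"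
    by (rule has_integral_spike[of "{t}", rotated 2]) (use eq in auto)
  moreover have "((\<lambda>s. reflection_kernel T a b G t s * h s) has_integral
      (LINT s|lebesgue_on {-T..T}. reflection_kernel T a b G t s * h s)) {-T..T}"
    by (rule has_integral_integral_lebesgue_on[OF int]) simp
  ultimately show "(LINT s|lebesgue_on {-T..T}. reflection_kernel T a b G t s * h s) = a * sol h (- t) - b * sol h t + sol' h t"
    by (rule has_integral_unique[rotated])
qed

end

section \<open>The first-order problem with reflection\<close>

text \<open>The interval is symmetric, so reflection maps it onto itself and merely swaps the
  one-sided derivatives at the ends.\<close>

lemma DERIV_reflect:
  assumes "(f has_real_derivative D) (at (- t) within {-T..T})"
  shows "((\<lambda>t. f (- t)) has_real_derivative - D) (at t within {-T..T})"
proof -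
  have "uminus ` {-T..T} = {-T..T}" by simp
  then have "(f has_real_derivative D) (at (- t) within uminus ` {-T..T})" using assms by simp
  from DERIV_image_chain[OF this DERIV_minus[OF DERIV_ident]] show ?thesis
    by (simp add: o_def)
qed

lemma reflection_solution_unique:
  assumes c: "c = a\<^sup>2 - b\<^sup>2"
    and x1: "reflection_solution T a b h x1" and x2: "reflection_solution T a b h x2" and t: "t \<in> {-T..T}"
  shows "x1 t = x2 t"
proof -
  define z where "z t = x1 t - x2 t" for t
  define w where "w t = - a * z (- t) - b * z t" for t
  have ac: "ac_primitive (-T) T z w"
    unfolding z_def[abs_def]
    by (rule ac_primitive_cong[OF ac_primitive_diff])
       (use x1 x2 in \<open>auto simp: reflection_solution_iff w_def z_def algebra_simps\<close>)
  have cz: "continuous_on {-T..T} z" by (rule ac_primitive_imp_continuous_on[OF ac])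
  have "continuous_on {-T..T} w"
    unfolding w_def[abs_def]
    by (intro continuous_intros cz continuous_on_compose2[OF cz]) auto
  then have z: "(z has_real_derivative w t) (at t within {-T..T})" if "t \<in> {-T..T}" for t
    using that by (rule ac_primitive_has_real_derivative[OF ac])
  have w: "(w has_real_derivative - c * z t) (at t within {-T..T})" if t: "t \<in> {-T..T}" for t
  proof -
    have "- t \<in> {-T..T}" using t by simp
    from DERIV_diff[OF DERIV_cmult[OF DERIV_reflect[OF z[OF this]], of "- a"] DERIV_cmult[OF z[OF t], of b]]
    have "(w has_real_derivative - a * - w (- t) - b * w t) (at t within {-T..T})"
      unfolding w_def[abs_def] .
    \<comment> \<open>Using the first-order relation a second time cancels the mixed terms
      \<open>a * b * z (- t)\<close>.\<close>
    moreover have "- a * - w (- t) - b * w t = - c * z t"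
      by (simp add: w_def c power2_eq_square algebra_simps)
    ultimately show ?thesis by simp
  qed
  have per: "z (- T) = z T"
    using x1 x2 by (simp add: reflection_solution_iff z_def)
  \<comment> \<open>The reflection exchanges the ends, so \<open>w\<close> inherits periodicity from
    \<open>z\<close>.\<close>
  then have "w (- T) = w T" by (simp add: w_def)
  from periodic_homogeneous_zero[OF z w per this t] show ?thesis
    by (simp add: z_def)
qed

text \<open>Phrased for any \<open>u\<close> that agrees with the closed form on the interval, since
  the kernel integral is identified with it only there.\<close>

lemma reflection_solution_green:
  assumes c: "c = a\<^sup>2 - b\<^sup>2" and h: "integrable (lebesgue_on {-T..T}) h"
    and u: "\<And>t. t \<in> {-T..T} \<Longrightarrow> u t = a * sol h (- t) - b * sol h t + sol' h t"
  shows "reflection_solution T a b h u"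
proof -
  have T: "T \<in> {-T..T}" "- T \<in> {-T..T}" using T_pos by auto
  note s = sol_has_derivative[OF h]
  \<comment> \<open>These two terms are continuously differentiable; only the third,
    \<open>sol' h\<close>, is handled as an almost-everywhere primitive.\<close>
  have "((\<lambda>t. a * sol h (- t) - b * sol h t) has_real_derivative a * - sol' h (- t) - b * sol' h t) (at t within {-T..T})"
    if "t \<in> {-T..T}" for t
    using that by (intro DERIV_diff DERIV_cmult DERIV_reflect s) auto
  moreover have cs: "continuous_on {-T..T} (sol' h)"
    by (rule ac_primitive_imp_continuous_on[OF ac_primitive_sol'[OF h]])
  have "continuous_on {-T..T} (\<lambda>t. a * - sol' h (- t) - b * sol' h t)"
    by (intro continuous_intros cs continuous_on_compose2[OF cs]) auto
  ultimately have "ac_primitive (- T) T (\<lambda>t. a * sol h (- t) - b * sol h t) (\<lambda>t. a * - sol' h (- t) - b * sol' h t)"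
    by (rule ac_primitive_C1)
  from ac_primitive_add[OF this ac_primitive_sol'[OF h]]
  have "ac_primitive (- T) T u (\<lambda>t. a * - sol' h (- t) - b * sol' h t + (h t - c * sol h t))"
    by (rule ac_primitive_transform) (simp add: u)
  then have "ac_primitive (- T) T u (\<lambda>t. h t - a * u (- t) - b * u t)"
    by (rule ac_primitive_cong) (simp add: u c power2_eq_square algebra_simps)
  moreover have "u (- T) = u T"
    using sol_periodic[OF h] by (simp add: u[OF T(1)] u[OF T(2)])
  ultimately show ?thesis by (simp add: reflection_solution_iff)
qed

end

section \<open>From the spectral condition to the locale, and the conclusion\<close>

lemma nonresonant_if_not_eigenvalue:
  assumes "T > 0" and c: "\<forall>n::nat. c \<noteq> (real n)\<^sup>2 * (pi / T)\<^sup>2"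
  shows "nonresonant T c"
proof
  show "0 < T" by fact
  show nz: "c \<noteq> 0" using c[rule_format, of 0] by simp
  show "gsin c T \<noteq> 0"
  proof
    assume *: "gsin c T = 0"
    show False
    proof (cases "0 < c")
      case True
      then have "sin (sqrt c * T) = 0" using * by (simp add: gsin_def)
      then obtain i :: int where i: "sqrt c * T = of_int i * pi"
        unfolding sin_zero_iff_int2 by blast
      have "c = (sqrt c)\<^sup>2" using True by simp
      also have "sqrt c = of_int i * (pi / T)" using i \<open>0 < T\<close> by (simp add: field_simps)
      \<comment> \<open>The zero of the sine comes with an integer \<open>i\<close> of either sign;
        squaring allows the natural number \<open>nat \<bar>i\<bar>\<close> instead, which
        contradicts the hypothesis.\<close>
      also have "(of_int i * (pi / T))\<^sup>2 = (real (nat \<bar>i\<bar>))\<^sup>2 * (pi / T)\<^sup>2"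
        unfolding power_mult_distrib by simp
      finally show False using c by blast
    next
      case False
      then show False using * nz \<open>0 < T\<close> by (simp add: gsin_def)
    qed
  qed
qed

theorem mainTheorem5:
  fixes T a b :: real and h :: "real \<Rightarrow> real"
  assumes "T > 0"
    and "integrable (lebesgue_on {-T..T}) h"
    and "\<forall>n::nat. a\<^sup>2 - b\<^sup>2 \<noteq> (real n)\<^sup>2 * (pi / T)\<^sup>2"
  shows "(\<exists>G. periodic_greens_function T (a\<^sup>2 - b\<^sup>2) G) \<and>
    (\<forall>G. periodic_greens_function T (a\<^sup>2 - b\<^sup>2) G \<longrightarrow>
      (\<forall>t\<in>{-T..T}. \<forall>s\<in>{-T..T}. t \<noteq> s \<longrightarrow>
         (\<lambda>r. G r s) differentiable (at t within {-T..T})) \<and>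
      (\<forall>t\<in>{-T..T}. integrable (lebesgue_on {-T..T}) (\<lambda>s. reflection_kernel T a b G t s * h s)) \<and>
      (let u = (\<lambda>t. LINT s|lebesgue_on {-T..T}. reflection_kernel T a b G t s * h s) in
         reflection_solution T a b h u \<and>
         (\<forall>x. reflection_solution T a b h x \<longrightarrow> (\<forall>t\<in>{-T..T}. x t = u t))))"
proof -
  interpret nonresonant T "a\<^sup>2 - b\<^sup>2"
    using assms(1,3) by (rule nonresonant_if_not_eigenvalue)
  note h = assms(2)
  show ?thesis
    unfolding Let_def
  proof (intro conjI allI impI ballI)
    show "\<exists>G. periodic_greens_function T (a\<^sup>2 - b\<^sup>2) G"
      by (rule exI) (rule periodic_greens_function_green)
  next
    fix G t s
    assume "periodic_greens_function T (a\<^sup>2 - b\<^sup>2) G" "t \<in> {-T..T}" "s \<in> {-T..T}" "t \<noteq> s"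
    from periodic_greens_function_has_derivative[OF this]
    show "(\<lambda>r. G r s) differentiable (at t within {-T..T})"
      by (rule differentiableI[OF has_field_derivative_imp_has_derivative])
  next
    fix G t
    assume "periodic_greens_function T (a\<^sup>2 - b\<^sup>2) G" "t \<in> {-T..T}"
    then show "integrable (lebesgue_on {-T..T}) (\<lambda>s. reflection_kernel T a b G t s * h s)"
      using reflection_kernel_integrable[OF _ h] by simp
  next
    fix G assume G: "periodic_greens_function T (a\<^sup>2 - b\<^sup>2) G"
    let ?u = "\<lambda>t. LINT s|lebesgue_on {-T..T}. reflection_kernel T a b G t s * h s"
    show u: "reflection_solution T a b h ?u"
      by (rule reflection_solution_green[OF refl h LINT_reflection_kernel[OF G h]])
    fix x t assume "reflection_solution T a b h x" "t \<in> {-T..T}"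
    then show "x t = ?u t"
      by (rule reflection_solution_unique[OF refl _ u])
  qed
qed

end
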